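(* Let $G$ be a finite simple planar graph such that any two distinct cycles of $G$ of length at most $4$ are independent (i.e., share no common vertex). Then $a^*_{eq}(G)\leq 3$; that is, for every integer $t\geq 3$, $G$ admits an equitable $t$-tree-coloring.
   Context: All graphs are finite, simple and undirected. An equitable $k$-tree-coloring of a graph $G$ is a partition of $V(G)$ into $k$ subsets such that each subset has size either $\lceil |V(G)|/k\rceil$ or $\lfloor |V(G)|/k\rfloor$ and each subset induces a forest in $G$. The strong equitable vertex arboricity $a^*_{eq}(G)$ is the smallest integer $t$ such that $G$ has an equitable $t'$-tree-coloring for every integer $t'\geq t$. Two cycles are independent if they share no common vertices. *)

theory Defs
  imports "HOL-Analysis.Analysis"
begin

definition simple_graph :: "'a set \<Rightarrow> 'a set set \<Rightarrow> bool" where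
  "simple_graph V E \<longleftrightarrow> finite V \<and> (\<forall>e\<in>E. e \<subseteq> V \<and> card e = 2)"

(* A plane drawing: vertices are distinct points, edges are simple arcs between their
   end vertices that meet vertices and each other only in common end vertices. *)
definition planar_graph :: "'a set \<Rightarrow> 'a set set \<Rightarrow> bool" where
  "planar_graph V E \<longleftrightarrow>
     (\<exists>(p :: 'a \<Rightarrow> complex) (\<gamma> :: 'a set \<Rightarrow> real \<Rightarrow> complex).
        inj_on p V \<and>
        (\<forall>e\<in>E. arc (\<gamma> e) \<and> {pathstart (\<gamma> e), pathfinish (\<gamma> e)} = p ` e \<and>
           path_image (\<gamma> e) \<inter> p ` V = p ` e) \<and>
        (\<forall>e\<in>E. \<forall>f\<in>E. e \<noteq> f \<longrightarrow>
           path_image (\<gamma> e) \<inter> path_image (\<gamma> f) = p ` (e \<inter> f)))"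

(* A cycle is a subgraph without isolated vertices, so it is represented by its edge set C:
   its vertex set is \<Union>C and its length is card C. *)
definition is_cycle :: "'a set set \<Rightarrow> 'a set set \<Rightarrow> bool" where
  "is_cycle E C \<longleftrightarrow> C \<subseteq> E \<and>
     (\<exists>vs. 3 \<le> length vs \<and> distinct vs \<and>
        C = {{vs ! i, vs ! (Suc i mod length vs)} | i. i < length vs})"

definition independent_cycles :: "'a set set \<Rightarrow> 'a set set \<Rightarrow> bool" where
  "independent_cycles C D \<longleftrightarrow> \<Union>C \<inter> \<Union>D = {}"

definition induced_edges :: "'a set set \<Rightarrow> 'a set \<Rightarrow> 'a set set" where
  "induced_edges E S = {e \<in> E. e \<subseteq> S}"

definition is_forest :: "'a set set \<Rightarrow> bool" where
  "is_forest E \<longleftrightarrow> \<not> (\<exists>C. is_cycle E C)"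

(* The parts are indexed by {..<k} because some of them are empty when k > card V. *)
definition equitable_tree_coloring ::
  "'a set \<Rightarrow> 'a set set \<Rightarrow> nat \<Rightarrow> (nat \<Rightarrow> 'a set) \<Rightarrow> bool" where
  "equitable_tree_coloring V E k P \<longleftrightarrow>
     disjoint_family_on P {..<k} \<and> (\<Union>i<k. P i) = V \<and>
     (\<forall>i<k. (int (card (P i)) = \<lceil>real (card V) / real k\<rceil> \<or>
             int (card (P i)) = \<lfloor>real (card V) / real k\<rfloor>) \<and>
            is_forest (induced_edges E (P i)))"

definition has_equitable_tree_coloring :: "'a set \<Rightarrow> 'a set set \<Rightarrow> nat \<Rightarrow> bool" where
  "has_equitable_tree_coloring V E k \<longleftrightarrow> (\<exists>P. equitable_tree_coloring V E k P)"

definition strong_equitable_vertex_arboricity :: "'a set \<Rightarrow> 'a set set \<Rightarrow> nat" where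
  "strong_equitable_vertex_arboricity V E =
     (LEAST t. 1 \<le> t \<and> (\<forall>t'\<ge>t. has_equitable_tree_coloring V E t'))"

end

theory Submission
  imports Defs
begin

text \<open>
  It suffices to find vertices \<open>x\<^sub>1, \<dots>, x\<^sub>t\<close> such that \<open>x\<^sub>i\<close> has at most \<open>2i - 1\<close> neighbours
  outside \<open>S = {x\<^sub>1, \<dots>, x\<^sub>t}\<close>: an equitable tree colouring of \<open>G - S\<close> extends greedily, colouring
  \<open>x\<^sub>t\<close> first, with pairwise distinct colours and at most one neighbour of \<open>x\<^sub>i\<close> in its colour class.
  Such vertices exist if \<open>G\<close> has a vertex of degree at most 1, a 2-vertex with a neighbour of degree
  at most 6, a 3-vertex with two neighbours of degrees at most 4 and 6, or a triangle formed by a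
  3-vertex and vertices of degrees at most 5 and 7.

  If none of these occurs, assign to a vertex of degree 2, 3, 4, 5--6, at least 7 the weight
  36, 24, 20, 15, 12, and to an edge \<open>uv\<close> the length \<open>72 - a(u) - a(v)\<close>. Every cycle of length at
  least 5 then has total length at least 144. Counting face boundaries in Euler's inequality
  \<open>F \<ge> |E| - |V| + 2\<close>, where the deficits of the (pairwise disjoint) short cycles are paid by the surplus
  \<open>d(v) a(v) - 72\<close> of their vertices, gives a contradiction.

  The facts about faces come from Janiszewski's theorem: an arc borders at most two components
  of the complement, an edge closing a cycle creates a new face, and forests do not separate.
\<close>

section \<open>Complements of arcs\<close>

lemma connected_Un_inserting_closure_point:
  fixes S T :: "'a::topological_space set"
  assumes "connected S" "connected T" "x \<in> closure S" "x \<in> closure T" "S \<noteq> {}"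
  shows "connected (insert x (S \<union> T))"
proof -
  have "connected (insert x S)" "connected (insert x T)"
    using assms by (auto intro: connected_intermediate_closure closure_subset[THEN subsetD])
  then have "connected (insert x S \<union> insert x T)"
    by (intro connected_Un) auto
  then show ?thesis by simp
qed

lemma frontier_component_Compl_subset:
  fixes K :: "'a::euclidean_space set"
  assumes "closed K" "W \<in> components (- K)"
  shows "frontier W \<subseteq> K"
  using frontier_of_components_closed_complement[OF assms] by simp

lemma arc_image_interval:
  assumes "arc g" "0 \<le> a" "a < b" "b \<le> 1"
  shows "compact (g ` {a..b})" "connected (g ` {a..b})"
    and "connected (- (g ` {a..b} :: complex set))"
proof -
  have 1: "path_image (subpath a b g) = g ` {a..b}"
    using assms by (simp add: path_image_subpath)
  have 2: "arc (subpath a b g)"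
    using assms by (intro arc_subpath_arc) auto
  show "compact (g ` {a..b})" "connected (g ` {a..b})"
    using compact_arc_image[OF 2] connected_arc_image[OF 2] 1 by auto
  show "connected (- (g ` {a..b}))"
    using connected_arc_complement[OF 2] 1 by simp
qed

lemma arc_eq_iff:
  assumes "arc g" "s \<in> {0..1}" "t \<in> {0..1}"
  shows "g s = g t \<longleftrightarrow> s = t"
  using assms by (auto simp: arc_def inj_on_def)

lemma arc_mem_image_interval:
  assumes "arc g" "0 \<le> u" "u \<le> 1" "0 \<le> a" "b \<le> 1"
  shows "g u \<in> g ` {a..b} \<longleftrightarrow> a \<le> u \<and> u \<le> b"
proof -
  have "inj_on g {0..1}" "u \<in> {0..1}" "{a..b} \<subseteq> {0..1}" using assms by (auto simp: arc_def)
  then show ?thesis by (metis inj_on_image_mem_iff atLeastAtMost_iff)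
qed

lemma arc_open_image:
  assumes "arc g"
  shows "g ` {0<..<1} = path_image g - {pathstart g, pathfinish g}"
proof -
  have "\<And>t. t \<in> {0..1} \<Longrightarrow> g t \<noteq> g 0 \<Longrightarrow> g t \<noteq> g 1 \<Longrightarrow> t \<in> {0<..<1}"
    by (metis atLeastAtMost_iff greaterThanLessThan_iff less_eq_real_def)
  then show ?thesis
    using arc_eq_iff[OF assms] by (force simp: path_image_def pathstart_def pathfinish_def)
qed

lemma arc_interior_notin:
  assumes "arc g" "path_image g \<inter> A \<subseteq> {pathstart g, pathfinish g}" "0 < u" "u < 1"
  shows "g u \<notin> A"
proof -
  have "g u \<in> path_image g - {pathstart g, pathfinish g}"
    unfolding arc_open_image[OF assms(1), symmetric] using assms by auto
  then show ?thesis using assms by blast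
qed

text \<open>Two halves of the arc are attached to \<open>A\<close> at one point each, so by Janiszewski's theorem
  they separate nothing that \<open>A\<close> does not separate.\<close>

lemma arc_in_closure_component:
  fixes A :: "complex set"
  assumes A: "compact A" and g: "arc g"
    and int: "path_image g \<inter> A \<subseteq> {pathstart g, pathfinish g}"
    and W: "W \<in> components (- (A \<union> path_image g))"
    and s: "0 < s" "s < 1" "g s \<in> closure W"
    and t: "0 < t" "t < 1"
  shows "g t \<in> closure W"
proof (rule ccontr)
  assume nt: "g t \<notin> closure W"
  have cont: "continuous_on {0..1} g" using g by (simp add: arc_def path_def)
  have op: "open (- closure W)" by auto
  have "continuous (at t) g"
    using cont t by (intro continuous_on_interior[of "{0..1}"]) auto
  then have "eventually (\<lambda>u. g u \<in> - closure W) (at t)"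
    using topological_tendstoD[OF _ op] nt by (auto simp: isCont_def)
  then obtain d where d: "d > 0" "\<And>u. dist u t < d \<Longrightarrow> g u \<notin> closure W"
    using nt unfolding eventually_at by (metis ComplD UNIV_I)
  \<comment> \<open>The gap \<open>(t-c, t+c)\<close> must stay where \<open>g\<close> avoids
    \<open>closure W\<close>, hence \<open>d/2\<close>, and inside \<open>(0,1)\<close>, hence the
    halves of \<open>t\<close> and \<open>1-t\<close>.\<close>
  define c where "c = min (d/2) (min (t/2) ((1-t)/2))"
  have c: "c > 0" "c \<le> d/2" "c \<le> t/2" "c \<le> (1-t)/2" using d t by (auto simp: c_def min_def)
  define e1 where "e1 = g ` {0..t-c}"
  define e2 where "e2 = g ` {t+c..1}"
  have e1: "compact e1" "connected (- e1)" and e2: "compact e2" "connected (- e2)"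
    using arc_image_interval[OF g, of 0 "t-c"] arc_image_interval[OF g, of "t+c" 1] c t
    by (auto simp: e1_def e2_def)
  have inj: "\<And>u v. u \<in> {0..1} \<Longrightarrow> v \<in> {0..1} \<Longrightarrow> g u = g v \<longleftrightarrow> u = v"
    using arc_eq_iff[OF g] by blast
  have nA: "g u \<notin> A" if "u \<in> {0<..<1}" for u
    using arc_interior_notin[OF g int] that by auto
  have A_e1: "A \<inter> e1 \<subseteq> {g 0}"
  proof
    fix x assume "x \<in> A \<inter> e1"
    then obtain u where u: "x = g u" "0 \<le> u" "u \<le> t - c" "g u \<in> A" by (auto simp: e1_def)
    with nA[of u] c t have "u = 0" by (cases "u = 0") auto
    then show "x \<in> {g 0}" using u by simp
  qed
  have Ae_e2: "(A \<union> e1) \<inter> e2 \<subseteq> {g 1}"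
  proof
    fix x assume x: "x \<in> (A \<union> e1) \<inter> e2"
    then obtain u where u: "x = g u" "t + c \<le> u" "u \<le> 1" by (auto simp: e2_def)
    have "x \<notin> e1" using u c t by (simp add: e1_def arc_mem_image_interval[OF g])
    with x u nA[of u] c t have "u = 1" by (cases "u = 1") auto
    then show "x \<in> {g 1}" using u by simp
  qed
  have conn1: "connected (A \<inter> e1)" "connected ((A \<union> e1) \<inter> e2)"
    using A_e1 Ae_e2 by (metis connected_empty connected_sing subset_singletonD)+
  obtain a where a: "a \<in> W" using W in_components_nonempty by blast
  have W': "connected W" "W \<subseteq> - (A \<union> path_image g)" using W in_components_connected in_components_subset by blast+
  \<comment> \<open>\<open>W\<close> and the open arc, glued at \<open>g s\<close>, form a connected
    subset of \<open>- A\<close> that joins \<open>a\<close> to \<open>g t\<close>.\<close>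
  have "connected (g ` {0<..<1})"
    using cont by (intro connected_continuous_image) (auto intro: continuous_on_subset)
  moreover have "g s \<in> closure (g ` {0<..<1})" using s by (auto intro!: closure_subset[THEN subsetD])
  ultimately have "connected (insert (g s) (W \<union> g ` {0<..<1}))"
    using W' s a by (intro connected_Un_inserting_closure_point) auto
  moreover have "insert (g s) (W \<union> g ` {0<..<1}) \<subseteq> - A" using W' nA s by auto
  moreover have "a \<in> insert (g s) (W \<union> g ` {0<..<1})" "g t \<in> insert (g s) (W \<union> g ` {0<..<1})"
    using a t by auto
  ultimately have cA: "connected_component (- A) a (g t)"
    unfolding connected_component_def by metis
  have "e1 \<subseteq> path_image g" "e2 \<subseteq> path_image g"
    using c t by (auto simp: e1_def e2_def path_image_def)
  then have ae: "a \<notin> e1" "a \<notin> e2" using a W' by auto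
  have "g t \<notin> e1" "g t \<notin> e2"
    using c t by (simp_all add: e1_def e2_def arc_mem_image_interval[OF g])
  with ae have cE: "connected_component (- e1) a (g t)" "connected_component (- e2) a (g t)"
    using e1 e2 by (auto simp: connected_component_def)
  have "connected_component (- (A \<union> e1)) a (g t)"
    using A e1 conn1 cA cE by (intro Janiszewski) (auto simp: compact_imp_closed)
  then have "connected_component (- (A \<union> e1 \<union> e2)) a (g t)"
    using A e1 e2 conn1 cA cE by (intro Janiszewski) (auto simp: compact_imp_closed)
  then obtain T where T: "connected T" "T \<subseteq> - (A \<union> e1 \<union> e2)" "a \<in> T" "g t \<in> T"
    by (auto simp: connected_component_def)
  \<comment> \<open>\<open>T\<close> leaves \<open>W\<close>, so it crosses
    \<open>frontier W\<close>, which lies in \<open>A\<close> or on the arc. As \<open>T\<close>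
    avoids \<open>A\<close>, \<open>e1\<close> and \<open>e2\<close>, the crossing falls into the
    gap, where \<open>g\<close> avoids \<open>closure W\<close>.\<close>
  have "g t \<notin> W" using W' t by (auto simp: path_image_def)
  then have "T \<inter> frontier W \<noteq> {}"
    using T a by (intro connected_Int_frontier) auto
  then obtain x where x: "x \<in> T" "x \<in> frontier W" by auto
  have "x \<in> A \<union> path_image g"
    using frontier_component_Compl_subset[OF _ W] x A g
    by (meson closed_Un closed_arc_image compact_imp_closed subsetD)
  then obtain u where u: "x = g u" "0 \<le> u" "u \<le> 1" using x T by (auto simp: path_image_def)
  have "t - c < u" "u < t + c" using u x T by (force simp: e1_def e2_def)+
  then have "dist u t < d" using c d by (auto simp: dist_real_def)
  then show False using d(2) x u by (auto simp: frontier_def)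
qed

text \<open>From a point \<open>a\<close> of \<open>W\<close> near \<open>g s\<close>, the segment
  to a nearest point of \<open>A \<union> path_image g\<close> stays in \<open>W\<close> up to its
  end, because every earlier point is strictly closer to \<open>a\<close> than that set. Excluding
  \<open>y0\<close> allows a second accessible point, different from a first one, to be
  chosen.\<close>

lemma component_accessible_arc_point:
  fixes A :: "complex set"
  assumes A: "closed A" and g: "arc g"
    and int: "path_image g \<inter> A \<subseteq> {pathstart g, pathfinish g}"
    and W: "W \<in> components (- (A \<union> path_image g))"
    and s: "0 < s" "s < 1" "g s \<in> closure W" "g s \<noteq> y0"
  obtains a r where "a \<in> W" "0 < r" "r < 1" "g r \<noteq> y0" "closed_segment a (g r) - {g r} \<subseteq> W"
proof -
  let ?K = "A \<union> path_image g"
  have K: "closed ?K" using A g by (auto simp: closed_arc_image)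
  have nA: "g s \<notin> A" using arc_interior_notin[OF g int s(1,2)] .
  have "g s \<noteq> g 0" "g s \<noteq> g 1" using arc_eq_iff[OF g, of s] s by auto
  then have "g s \<in> - (A \<union> {g 0, g 1, y0})" using nA s by auto
  moreover have "open (- (A \<union> {g 0, g 1, y0}))" using A by (intro open_Compl closed_Un) auto
  ultimately obtain e where e: "e > 0" "ball (g s) e \<subseteq> - (A \<union> {g 0, g 1, y0})"
    by (meson open_contains_ball)
  \<comment> \<open>Radius \<open>e/2\<close> keeps the nearest point \<open>y\<close> of the closed
    set within \<open>e\<close> of \<open>g s\<close>, where that set consists of interior arc
    points other than \<open>y0\<close>.\<close>
  obtain a where a: "a \<in> W" "dist a (g s) < e/2"
    using s(3) e by (metis closure_approachable half_gt_zero)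
  have gsK: "g s \<in> ?K" using s by (auto simp: path_image_def)
  then obtain y where y: "y \<in> ?K" "\<And>z. z \<in> ?K \<Longrightarrow> dist a y \<le> dist a z"
    using distance_attains_inf[OF K, of a] by blast
  have "dist a y < e/2" using y(2)[OF gsK] a by simp
  then have "dist (g s) y < e" using a by (metis dist_commute dist_triangle_half_l)
  then have "y \<notin> A" "y \<noteq> g 0" "y \<noteq> g 1" "y \<noteq> y0" using e by (auto simp: subset_iff)
  then have "y \<in> g ` {0<..<1}" using y arc_open_image[OF g] by (auto simp: pathstart_def pathfinish_def)
  then obtain r where r: "y = g r" "0 < r" "r < 1" by auto
  have "z \<in> W" if z: "z \<in> closed_segment a y - {y}" for z
  proof -
    have "dist a y = dist a z + dist z y"
      using z by (simp flip: between between_mem_segment)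
    then have "dist a z < dist a y" using z by simp
    have "closed_segment a z \<inter> ?K = {}"
    proof -
      have "dist a w \<le> dist a z" if "w \<in> closed_segment a z" for w
        using that by (metis dist_commute dist_in_closed_segment)
      then show ?thesis using y(2) \<open>dist a z < dist a y\<close> by force
    qed
    then have "closed_segment a z \<subseteq> W"
      using W a by (intro components_maximal[OF W]) auto
    then show ?thesis by auto
  qed
  then show ?thesis using that a r \<open>y \<noteq> y0\<close> by blast
qed

text \<open>Join two points of the arc inside the third component by a continuum \<open>\<sigma>\<close>. Removing the
  part of the arc between them, or the parts outside, leaves the first two components together,
  and the two closed sets meet exactly in \<open>\<sigma>\<close>, contradicting Janiszewski's theorem.\<close>

lemma arc_at_most_two_sides:
  fixes A :: "complex set"
  assumes A: "compact A" and g: "arc g"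
    and int: "path_image g \<inter> A \<subseteq> {pathstart g, pathfinish g}"
    and W: "W1 \<in> components (- (A \<union> path_image g))" "W2 \<in> components (- (A \<union> path_image g))"
      "W3 \<in> components (- (A \<union> path_image g))"
    and cl: "\<exists>s\<in>{0<..<1}. g s \<in> closure W1" "\<exists>s\<in>{0<..<1}. g s \<in> closure W2"
      "\<exists>s\<in>{0<..<1}. g s \<in> closure W3"
    and ne: "W1 \<noteq> W3" "W2 \<noteq> W3"
  shows "W1 = W2"
proof -
  let ?K = "A \<union> path_image g"
  have inj: "\<And>u v. u \<in> {0..1} \<Longrightarrow> v \<in> {0..1} \<Longrightarrow> g u = g v \<longleftrightarrow> u = v"
    using arc_eq_iff[OF g] by blast
  have nA: "g u \<notin> A" if "u \<in> {0<..<1}" for u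
    using arc_interior_notin[OF g int] that by auto
  have clall: "g t \<in> closure W1" "g t \<in> closure W2" "g t \<in> closure W3" if "0 < t" "t < 1" for t
    using arc_in_closure_component[OF A g int W(1) _ _ _ that] arc_in_closure_component[OF A g int W(2) _ _ _ that]
      arc_in_closure_component[OF A g int W(3) _ _ _ that] cl by (simp_all add: Bex_def) blast+
  \<comment> \<open>A point off the open arc as forbidden value: it imposes no restriction on the
    first accessible point.\<close>
  obtain z0 where z0: "z0 \<notin> g ` {0<..<1}"
    by (metis arc_open_image DiffE g insertI1)
  have clA: "closed A" using A by (simp add: compact_imp_closed)
  note acc = component_accessible_arc_point[OF clA g int W(3)]
  obtain a r where a: "a \<in> W3" "0 < r" "r < 1" "closed_segment a (g r) - {g r} \<subseteq> W3"
    by (rule acc[of "1/2" z0]) (use clall z0 in auto)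
  \<comment> \<open>Any interior parameter other than \<open>r\<close> will do: the second
    accessible point is sought near \<open>g s'\<close> with \<open>g r\<close> forbidden.\<close>
  define s' where "s' = (if r = 1/2 then 1/3 else 1/2::real)"
  have "g s' \<noteq> g r" using inj[of s' r] a by (auto simp: s'_def)
  moreover have "0 < s'" "s' < 1" by (auto simp: s'_def)
  ultimately obtain b q where b: "b \<in> W3" "0 < q" "q < 1" "g q \<noteq> g r" "closed_segment b (g q) - {g q} \<subseteq> W3"
    using acc[of s' "g r"] clall(3)[of s'] by metis
  have "closed ?K" using clA g by (simp add: closed_arc_image closed_Un)
  then have "open W3" using open_components[OF _ W(3)] open_Compl by blast
  moreover have "connected W3" using W(3) in_components_connected by blast
  ultimately have "path_connected W3" by (simp add: connected_open_path_connected)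
  then obtain h where h: "path h" "path_image h \<subseteq> W3" "pathstart h = a" "pathfinish h = b"
    using a b unfolding path_connected_def by blast
  define \<sigma> where "\<sigma> = closed_segment a (g r) \<union> path_image h \<union> closed_segment b (g q)"
  have h': "a \<in> path_image h" "b \<in> path_image h" using h by auto
  have \<sigma>: "compact \<sigma>" "connected \<sigma>" "g r \<in> \<sigma>" "g q \<in> \<sigma>" "\<sigma> \<subseteq> W3 \<union> {g r, g q}"
  proof -
    have "connected (closed_segment a (g r) \<union> path_image h)"
      using h h' by (intro connected_Un) (auto simp: connected_path_image)
    then show "connected \<sigma>" unfolding \<sigma>_def
      using h' by - (rule connected_Un, auto)
    show "compact \<sigma>" unfolding \<sigma>_def using h by (intro compact_Un) (auto simp: compact_path_image)
    show "\<sigma> \<subseteq> W3 \<union> {g r, g q}" unfolding \<sigma>_def using a(4) b(5) h(2) by blast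
  qed (auto simp: \<sigma>_def)
  have disj: "W1 \<inter> W3 = {}" "W2 \<inter> W3 = {}"
    using components_nonoverlap W ne by blast+
  define r1 r2 where "r1 = min r q" and "r2 = max r q"
  have "r \<noteq> q" using b(4) by auto
  then have r12: "0 < r1" "r1 < r2" "r2 < 1" "{g r1, g r2} = {g r, g q}"
    using a b by (auto simp: r1_def r2_def min_def max_def)
  define S where "S = A \<union> g ` {0..r1} \<union> g ` {r2..1} \<union> \<sigma>"
  define T where "T = g ` {r1..r2} \<union> \<sigma>"
  have "S \<inter> T = \<sigma>"
  proof -
    have "A \<inter> g ` {r1..r2} = {}" using nA r12 by auto
    moreover have "g ` {0..r1} \<inter> g ` {r1..r2} = g ` ({0..r1} \<inter> {r1..r2})"
      "g ` {r2..1} \<inter> g ` {r1..r2} = g ` ({r2..1} \<inter> {r1..r2})"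
      by (rule inj_on_image_Int[of g "{0..1}", symmetric]; use g r12 in \<open>force simp: arc_def\<close>)+
    moreover have "{0..r1} \<inter> {r1..r2} = {r1}" "{r2..1} \<inter> {r1..r2} = {r2}" using r12 by auto
    moreover have "{g r1, g r2} \<subseteq> \<sigma>" using r12 \<sigma> by auto
    ultimately show ?thesis unfolding S_def T_def by (simp add: Int_Un_distrib2 Int_Un_distrib) blast
  qed
  have comp: "compact S" "compact T" unfolding S_def T_def
    using arc_image_interval[OF g] r12 A \<sigma> by (auto intro!: compact_Un)
  obtain a1 a2 where a12: "a1 \<in> W1" "a2 \<in> W2" using W in_components_nonempty by (metis ex_in_conv)
  have Wsub: "W1 \<subseteq> - ?K" "W2 \<subseteq> - ?K" "W3 \<subseteq> - ?K" using W in_components_subset by blast+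
  have "g r \<in> ?K" "g q \<in> ?K" using a b by (auto simp: path_image_def)
  then have W\<sigma>: "W1 \<inter> (?K \<union> \<sigma>) = {}" "W2 \<inter> (?K \<union> \<sigma>) = {}"
    using Wsub disj \<sigma>(5) by blast+
  have ST: "S \<subseteq> ?K \<union> \<sigma>" "T \<subseteq> ?K \<union> \<sigma>" "S \<union> T = ?K \<union> \<sigma>"
  proof -
    have "{0..1} = {0..r1} \<union> {r1..r2} \<union> {r2..1}" using r12 by auto
    then have "path_image g = g ` {0..r1} \<union> g ` {r1..r2} \<union> g ` {r2..1}"
      by (simp add: path_image_def image_Un)
    then show "S \<subseteq> ?K \<union> \<sigma>" "T \<subseteq> ?K \<union> \<sigma>" "S \<union> T = ?K \<union> \<sigma>" by (auto simp: S_def T_def)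
  qed
  \<comment> \<open>\<open>g u\<close> lies in the closures of both \<open>W1\<close> and
    \<open>W2\<close>, so the three together form a connected set that misses
    \<open>X\<close>.\<close>
  have conn: "connected_component (- X) a1 a2" if u: "0 < u" "u < 1" "g u \<notin> X" and X: "X \<subseteq> ?K \<union> \<sigma>" for u X
  proof -
    have "connected (insert (g u) (W1 \<union> W2))"
      using W clall u a12 by (intro connected_Un_inserting_closure_point) (auto intro: in_components_connected)
    moreover have "insert (g u) (W1 \<union> W2) \<subseteq> - X" using W\<sigma> X u by auto
    ultimately show ?thesis unfolding connected_component_def using a12 by blast
  qed
  have not\<sigma>: "g u \<notin> \<sigma>" if "0 < u" "u < 1" "u \<noteq> r1" "u \<noteq> r2" for u
  proof -
    have "g u \<notin> W3" using Wsub(3) that by (auto simp: path_image_def)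
    moreover have "g u \<noteq> g r1" "g u \<noteq> g r2" using inj[of u r1] inj[of u r2] that r12 by auto
    ultimately show ?thesis using \<sigma>(5) r12(4) by blast
  qed
  have "connected_component (- S) a1 a2"
    by (rule conn[of "(r1+r2)/2"]) (use r12 not\<sigma> nA ST in \<open>auto simp: S_def arc_mem_image_interval[OF g]\<close>)
  moreover have "connected_component (- T) a1 a2"
    by (rule conn[of "r1/2"]) (use r12 not\<sigma> nA ST in \<open>auto simp: T_def arc_mem_image_interval[OF g]\<close>)
  ultimately have "connected_component (- (S \<union> T)) a1 a2"
    using comp \<open>S \<inter> T = \<sigma>\<close> \<sigma> by (intro Janiszewski) (auto simp: compact_imp_closed)
  then obtain Z where Z: "connected Z" "Z \<subseteq> - ?K" "a1 \<in> Z" "a2 \<in> Z"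
    unfolding connected_component_def ST by blast
  then have "Z \<subseteq> W1" "Z \<subseteq> W2"
    using components_maximal[OF W(1), of Z] components_maximal[OF W(2), of Z] a12 by blast+
  then show ?thesis using components_nonoverlap[OF W(1) W(2)] Z by blast
qed

section \<open>The two sides of an arc and the number of complementary components\<close>

lemma component_near_arc_touches:
  fixes A :: "complex set"
  assumes A: "closed A" and g: "arc g"
    and U: "connected U" "U \<inter> A = {}" "x \<in> U" "x \<in> path_image g"
    and W: "W \<in> components (- (A \<union> path_image g))" "W \<inter> U \<noteq> {}"
    and ends: "pathstart g \<notin> U" "pathfinish g \<notin> U"
  shows "\<exists>s\<in>{0<..<1}. g s \<in> closure W"
proof -
  have "x \<notin> W" using U W in_components_subset by blast
  then have "U \<inter> frontier W \<noteq> {}" using U W by (intro connected_Int_frontier) auto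
  then obtain z where z: "z \<in> U" "z \<in> frontier W" by auto
  have "closed (A \<union> path_image g)" using A g by (auto simp: closed_arc_image)
  then have "z \<in> A \<union> path_image g" using frontier_component_Compl_subset W z by blast
  then have "z \<in> path_image g - {pathstart g, pathfinish g}" using z U ends by auto
  then have "z \<in> g ` {0<..<1}" using arc_open_image[OF g] by simp
  then show ?thesis using z by (auto simp: frontier_def)
qed

lemma arc_interior_ball:
  fixes A :: "complex set"
  assumes A: "closed A" and g: "arc g"
    and int: "path_image g \<inter> A \<subseteq> {pathstart g, pathfinish g}"
    and s: "s \<in> {0<..<1}"
  obtains e where "e > 0" "ball (g s) e \<inter> A = {}" "pathstart g \<notin> ball (g s) e" "pathfinish g \<notin> ball (g s) e"
proof -
  have "g s \<notin> A" using arc_interior_notin[OF g int] s by auto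
  moreover have "g s \<noteq> pathstart g" "g s \<noteq> pathfinish g"
    using arc_eq_iff[OF g, of s] s by (auto simp: pathstart_def pathfinish_def)
  ultimately have "g s \<in> - (A \<union> {pathstart g, pathfinish g})" by auto
  moreover have "open (- (A \<union> {pathstart g, pathfinish g}))" using A by (intro open_Compl closed_Un) auto
  ultimately obtain e where e: "e > 0" "ball (g s) e \<subseteq> - (A \<union> {pathstart g, pathfinish g})"
    by (meson open_contains_ball)
  then show ?thesis using that[of e] by blast
qed

lemma clopen_component_eq:
  fixes W X :: "'a::topological_space set"
  assumes "connected X" "W \<subseteq> X" "W \<noteq> {}" "X \<inter> frontier W = {}"
  shows "W = X"
  using connected_Int_frontier[of X W] assms by blast

text \<open>\<open>P\<close> and the arc are continua meeting exactly in the two ends, a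
  disconnected set, so the dual of Janiszewski's theorem makes
  \<open>P \<union> path_image g\<close> separate the plane. Each component of that complement
  contains a component for the larger set \<open>A \<union> path_image g\<close> that borders the
  arc.\<close>

lemma arc_two_sides:
  fixes A :: "complex set"
  assumes A: "compact A" and g: "arc g"
    and int: "path_image g \<inter> A \<subseteq> {pathstart g, pathfinish g}"
    and P: "P \<subseteq> A" "compact P" "connected P" "connected (- P)" "pathstart g \<in> P" "pathfinish g \<in> P"
  obtains (sides) W1 W2 where "W1 \<noteq> W2" "W1 \<in> components (- (A \<union> path_image g))" "W2 \<in> components (- (A \<union> path_image g))"
    "\<exists>s\<in>{0<..<1}. g s \<in> closure W1" "\<exists>s\<in>{0<..<1}. g s \<in> closure W2"
proof (rule ccontr)
  assume no: "\<not> thesis"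
  let ?K = "A \<union> path_image g" and ?L = "P \<union> path_image g"
  have clA: "closed A" using A by (simp add: compact_imp_closed)
  have clL: "closed ?L" using P g by (auto simp: compact_imp_closed closed_arc_image)
  have "P \<inter> path_image g = {pathstart g, pathfinish g}" using P int by auto
  moreover have "pathstart g \<noteq> pathfinish g" using g arc_distinct_ends by metis
  ultimately have "\<not> connected (P \<inter> path_image g)"
    using connected_finite_iff_sing[of "{pathstart g, pathfinish g}"] by auto
  then have nc: "\<not> connected (- ?L)"
    using Janiszewski_dual[of P "path_image g"] P g by (auto simp: compact_arc_image connected_arc_image)
  have mid: "g (1/2) \<in> path_image g" "g (1/2) \<notin> P"
    using arc_interior_notin[OF g int, of "1/2"] P by (auto simp: path_image_def)
  \<comment> \<open>\<open>- P\<close> is connected and larger than \<open>Z\<close>, so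
    \<open>frontier Z\<close> is not contained in \<open>P\<close> and reaches the open arc. A small
    ball there misses \<open>A\<close>, and a point of \<open>Z\<close> in it selects the component
    \<open>W\<close>.\<close>
  have key: "\<exists>W. W \<in> components (- ?K) \<and> W \<subseteq> Z \<and> (\<exists>s\<in>{0<..<1}. g s \<in> closure W)"
    if Z: "Z \<in> components (- ?L)" for Z
  proof -
    have Z': "Z \<noteq> {}" "Z \<subseteq> - ?L" using Z in_components_nonempty in_components_subset by blast+
    have "- P \<inter> frontier Z \<noteq> {}"
      using clopen_component_eq[of "- P" Z] P Z' mid by blast
    then obtain x where x: "x \<in> frontier Z" "x \<notin> P" by auto
    have "x \<in> ?L" using frontier_component_Compl_subset[OF clL Z] x by auto
    then have "x \<in> path_image g - {pathstart g, pathfinish g}" using x P by auto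
    then have "x \<in> g ` {0<..<1}" using arc_open_image[OF g] by simp
    then obtain s where s: "s \<in> {0<..<1}" "x = g s" by auto
    obtain e where e: "e > 0" "ball (g s) e \<inter> A = {}" "pathstart g \<notin> ball (g s) e" "pathfinish g \<notin> ball (g s) e"
      using arc_interior_ball[OF clA g int s(1)] by metis
    have "x \<in> closure Z" using x by (auto simp: frontier_def)
    then obtain z where z: "z \<in> Z" "dist z x < e" using e by (metis closure_approachable)
    then have zb: "z \<in> ball (g s) e" using s by (simp add: dist_commute)
    then have "z \<in> - ?K" using e z Z' by auto
    then obtain W where W: "W \<in> components (- ?K)" "z \<in> W" by (metis Union_components UnionE)
    have "\<exists>s\<in>{0<..<1}. g s \<in> closure W"
      by (rule component_near_arc_touches[OF clA g, of "ball (g s) e" "g s"])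
        (use e zb W s in \<open>auto simp: path_image_def\<close>)
    moreover have "W \<subseteq> Z"
      by (rule components_maximal[OF Z]) (use W z P in \<open>auto dest: in_components_connected in_components_subset\<close>)
    ultimately show ?thesis using W by blast
  qed
  have "Z = Z'" if "Z \<in> components (- ?L)" "Z' \<in> components (- ?L)" for Z Z'
  proof -
    obtain W where W: "W \<in> components (- ?K)" "W \<subseteq> Z" "\<exists>s\<in>{0<..<1}. g s \<in> closure W" using key \<open>Z \<in> _\<close> by blast
    obtain W' where W': "W' \<in> components (- ?K)" "W' \<subseteq> Z'" "\<exists>s\<in>{0<..<1}. g s \<in> closure W'" using key \<open>Z' \<in> _\<close> by blast
    have "W = W'" by (rule ccontr) (rule notE[OF no], rule sides[OF _ W(1) W'(1) W(3) W'(3)])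
    moreover have "W \<noteq> {}" using W in_components_nonempty by blast
    ultimately show ?thesis using components_nonoverlap[OF that] W W' by blast
  qed
  then have "connected (- ?L)"
    unfolding connected_eq_connected_components_eq by blast
  with nc show False by simp
qed

text \<open>The open arc lies in one component \<open>f0\<close> of \<open>- A\<close>. Both sides
  of the arc are parts of \<open>f0\<close>, and every other component of \<open>- A\<close>
  survives, so \<open>f0\<close> is replaced by at least two components.\<close>

lemma components_insert_arc:
  fixes A :: "complex set"
  assumes A: "compact A" and g: "arc g"
    and int: "path_image g \<inter> A \<subseteq> {pathstart g, pathfinish g}"
    and P: "P \<subseteq> A" "compact P" "connected P" "connected (- P)" "pathstart g \<in> P" "pathfinish g \<in> P"
    and fin: "finite (components (- (A \<union> path_image g)))"
  shows "Suc (card (components (- A))) \<le> card (components (- (A \<union> path_image g)))"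
proof -
  let ?K = "A \<union> path_image g"
  obtain W1 W2 where W: "W1 \<noteq> W2" "W1 \<in> components (- ?K)" "W2 \<in> components (- ?K)"
    "\<exists>s\<in>{0<..<1}. g s \<in> closure W1" "\<exists>s\<in>{0<..<1}. g s \<in> closure W2"
    by (rule arc_two_sides[OF A g int P])
  have clA: "closed A" using A by (simp add: compact_imp_closed)
  have gA: "g ` {0<..<1} \<subseteq> - A" using arc_interior_notin[OF g int] by auto
  have gcon: "connected (g ` {0<..<1})"
    using g by (intro connected_continuous_image) (auto simp: arc_def path_def intro: continuous_on_subset)
  obtain f0 where f0: "f0 \<in> components (- A)" "g ` {0<..<1} \<subseteq> f0"
    using exists_component_superset[OF gA _ gcon] gA W(4) by auto
  have opf: "open f0" using open_components[OF _ f0(1)] clA by blast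
  have sub: "W \<subseteq> f0" if t: "W \<in> components (- ?K)" "\<exists>s\<in>{0<..<1}. g s \<in> closure W" for W
  proof (rule components_maximal[OF f0(1)])
    show "connected W" using in_components_connected[OF t(1)] .
    show "W \<subseteq> - A" using in_components_subset[OF t(1)] by auto
    obtain s where s: "s \<in> {0<..<1}" "g s \<in> closure W" using t(2) by blast
    then have "g s \<in> f0" using f0 by auto
    then show "f0 \<inter> W \<noteq> {}" using s open_Int_closure_eq_empty[OF opf, of W] by blast
  qed
  have other: "f \<in> components (- ?K)" if f: "f \<in> components (- A)" "f \<noteq> f0" for f
  proof -
    have "f \<inter> f0 = {}" using components_nonoverlap f f0 by blast
    moreover have "path_image g \<subseteq> A \<union> g ` {0<..<1}"
      using arc_open_image[OF g] P by auto
    ultimately have fK: "f \<subseteq> - ?K" using f f0 in_components_subset by blast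
    moreover have "f \<noteq> {}" "connected f" using f in_components_nonempty in_components_connected by blast+
    ultimately show ?thesis
      using f unfolding in_components_maximal by blast
  qed
  have "components (- A) - {f0} \<subseteq> components (- ?K)" using other by blast
  then have fin1: "finite (components (- A) - {f0})" using fin finite_subset by blast
  have W1: "W \<notin> components (- A) - {f0}" if "W \<subseteq> f0" "W \<noteq> {}" for W
    using that components_nonoverlap[OF _ f0(1), of W] by blast
  define F where "F = components (- A) - {f0}"
  have F: "finite F" "W1 \<notin> F" "W2 \<notin> F"
    using fin1 W1[OF sub[OF W(2,4)] in_components_nonempty[OF W(2)]]
      W1[OF sub[OF W(3,5)] in_components_nonempty[OF W(3)]] unfolding F_def by blast+
  have "components (- A) = insert f0 F" "f0 \<notin> F" using f0(1) unfolding F_def by blast+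
  then have eq: "card (components (- A)) = Suc (card F)" using F by simp
  have "Suc (Suc (card F)) = card (insert W1 (insert W2 F))"
    using F W(1) by simp
  also have "\<dots> \<le> card (components (- ?K))"
  proof (rule card_mono[OF fin])
    show "insert W1 (insert W2 F) \<subseteq> components (- ?K)" using W(2,3) other unfolding F_def by blast
  qed
  finally show ?thesis using eq by simp
qed

section \<open>Paths, cycles and forests\<close>

text \<open>A list of vertices stands for the path through them in order; recursion at the head
  suits inductions that attach one edge at a time.\<close>

fun path_edges :: "'a list \<Rightarrow> 'a set set" where
  "path_edges (x # y # zs) = insert {x, y} (path_edges (y # zs))"
| "path_edges _ = {}"

lemma finite_path_edges [simp]: "finite (path_edges vs)"
  by (induction vs rule: path_edges.induct) auto

lemma Union_path_edges_subset: "\<Union>(path_edges vs) \<subseteq> set vs"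
  by (induction vs rule: path_edges.induct) auto

lemma path_edges_conv_nth: "path_edges vs = {{vs ! i, vs ! Suc i} | i. Suc i < length vs}"
proof (induction vs rule: path_edges.induct)
  case (1 x y zs)
  let ?vs = "x # y # zs"
  have "{{?vs ! i, ?vs ! Suc i} | i. Suc i < length ?vs} =
      insert {x, y} {{(y # zs) ! i, (y # zs) ! Suc i} | i. Suc i < length (y # zs)}" (is "?L = ?R")
  proof
    show "?L \<subseteq> ?R"
    proof
      fix e assume "e \<in> ?L"
      then obtain i where i: "Suc i < length ?vs" "e = {?vs ! i, ?vs ! Suc i}" by blast
      then show "e \<in> ?R" by (cases i) auto
    qed
    show "?R \<subseteq> ?L"
    proof
      fix e assume "e \<in> ?R"
      then consider "e = {x, y}" | i where "Suc i < length (y # zs)" "e = {(y # zs) ! i, (y # zs) ! Suc i}"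
        by blast
      then show "e \<in> ?L"
      proof cases
        case 1
        then have "e = {?vs ! 0, ?vs ! Suc 0}" "Suc 0 < length ?vs" by auto
        then show ?thesis by blast
      next
        case (2 i)
        then have "e = {?vs ! Suc i, ?vs ! Suc (Suc i)}" "Suc (Suc i) < length ?vs" by auto
        then show ?thesis by blast
      qed
    qed
  qed
  then show ?case using 1 by simp
qed auto

lemma path_edges_take_subset: "path_edges (take n vs) \<subseteq> path_edges vs"
  by (force simp: path_edges_conv_nth)

text \<open>Splitting off the index where \<open>Suc i mod length vs\<close> wraps to 0 turns the
  cyclic description into a path plus a closing edge, so list induction applies.\<close>

lemma is_cycle_iff:
  "is_cycle E C \<longleftrightarrow> C \<subseteq> E \<and> (\<exists>vs. 3 \<le> length vs \<and> distinct vs \<and>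
      C = insert {last vs, hd vs} (path_edges vs))"
proof -
  have "{{vs ! i, vs ! (Suc i mod length vs)} | i. i < length vs} = insert {last vs, hd vs} (path_edges vs)"
    (is "?L = ?R") if n: "3 \<le> length vs" for vs :: "'a list"
  proof
    have ne: "vs \<noteq> []" using n by auto
    show "?L \<subseteq> ?R"
    proof
      fix e assume "e \<in> ?L"
      then obtain i where i: "i < length vs" "e = {vs ! i, vs ! (Suc i mod length vs)}" by blast
      show "e \<in> ?R"
      proof (cases "Suc i < length vs")
        case True
        then show ?thesis using i by (auto simp: path_edges_conv_nth)
      next
        case False
        then have "i = length vs - 1" "Suc i = length vs" using i by auto
        then show ?thesis using i ne by (simp add: last_conv_nth hd_conv_nth)
      qed
    qed
    have "{last vs, hd vs} = {vs ! (length vs - 1), vs ! (Suc (length vs - 1) mod length vs)}"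
      using ne by (simp add: last_conv_nth hd_conv_nth)
    moreover have "length vs - 1 < length vs" using ne by simp
    ultimately have "{last vs, hd vs} \<in> ?L" by blast
    moreover have "path_edges vs \<subseteq> ?L"
    proof
      fix e assume "e \<in> path_edges vs"
      then obtain i where i: "Suc i < length vs" "e = {vs ! i, vs ! Suc i}"
        by (auto simp: path_edges_conv_nth)
      moreover have "Suc i mod length vs = Suc i" using i by simp
      ultimately show "e \<in> ?L" using Suc_lessD[OF i(1)] by force
    qed
    ultimately show "?R \<subseteq> ?L" by blast
  qed
  then show ?thesis unfolding is_cycle_def by (metis (no_types, lifting))
qed

lemma is_cycle_mono: "is_cycle E C \<Longrightarrow> E \<subseteq> E' \<Longrightarrow> is_cycle E' C"
  by (auto simp: is_cycle_def)

lemma is_cycle_subset: "is_cycle E C \<Longrightarrow> C \<subseteq> E"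
  by (auto simp: is_cycle_def)

lemma is_cycle_restrict: "is_cycle E C \<Longrightarrow> C \<subseteq> E' \<Longrightarrow> is_cycle E' C"
  by (auto simp: is_cycle_def)

lemma is_forest_mono: "is_forest E \<Longrightarrow> E' \<subseteq> E \<Longrightarrow> is_forest E'"
  unfolding is_forest_def using is_cycle_mono by blast

text \<open>An edge of the path joins neighbouring positions, while the first and the last position
  are at least two apart.\<close>

lemma closing_edge_notin_path_edges:
  assumes "3 \<le> length vs" "distinct vs"
  shows "{last vs, hd vs} \<notin> path_edges vs"
proof
  assume "{last vs, hd vs} \<in> path_edges vs"
  then obtain i where i: "Suc i < length vs" "{last vs, hd vs} = {vs ! i, vs ! Suc i}"
    by (auto simp: path_edges_conv_nth)
  have ne: "vs \<noteq> []" using assms by auto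
  then have "vs ! (length vs - 1) = vs ! i \<and> vs ! 0 = vs ! Suc i \<or>
      vs ! (length vs - 1) = vs ! Suc i \<and> vs ! 0 = vs ! i"
    using i by (auto simp: last_conv_nth hd_conv_nth doubleton_eq_iff)
  moreover have "\<And>j k. j < length vs \<Longrightarrow> k < length vs \<Longrightarrow> vs ! j = vs ! k \<longleftrightarrow> j = k"
    using assms by (simp add: nth_eq_iff_index_eq)
  moreover have "length vs - 1 < length vs" "0 < length vs" "i < length vs" using i by auto
  ultimately have "0 = Suc i \<or> length vs - 1 = Suc i \<and> 0 = i" using i(1) by metis
  then show False using assms by auto
qed

text \<open>Inner vertices lie on two edges of the path, the ends on one. A single vertex fits as
  well, being both \<open>hd\<close> and \<open>last\<close>.\<close>

lemma sum_path_edges: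
  fixes a :: "'a \<Rightarrow> 'b::comm_ring_1"
  assumes "distinct vs" "vs \<noteq> []"
  shows "(\<Sum>e\<in>path_edges vs. sum a e) = 2 * sum a (set vs) - a (hd vs) - a (last vs)"
  using assms
proof (induction vs rule: path_edges.induct)
  case (1 x y zs)
  have "{x, y} \<notin> path_edges (y # zs)"
    using Union_path_edges_subset[of "y # zs"] 1 by auto
  then show ?case using 1 by (simp add: algebra_simps)
qed auto

lemma cycle_length_obtain:
  assumes "is_cycle E C"
  obtains vs where "3 \<le> length vs" "distinct vs" "C = insert {last vs, hd vs} (path_edges vs)"
    "card C = length vs" "\<Union>C = set vs"
proof -
  obtain vs where vs: "3 \<le> length vs" "distinct vs" "C = insert {last vs, hd vs} (path_edges vs)"
    using assms unfolding is_cycle_iff by blast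
  have ne: "vs \<noteq> []" using vs by auto
  have ln: "last vs \<noteq> hd vs" using vs ne
    by (auto simp: last_conv_nth hd_conv_nth nth_eq_iff_index_eq)
  have e2: "card e = 2" if "e \<in> path_edges vs" for e
    using that vs by (auto simp: path_edges_conv_nth nth_eq_iff_index_eq)
  \<comment> \<open>Weight 1 turns the double count into the number of path edges.\<close>
  have "(\<Sum>e\<in>path_edges vs. sum (\<lambda>_. 1::int) e) = (\<Sum>e\<in>path_edges vs. 2)"
    using e2 by (intro sum.cong) auto
  then have "2 * int (card (path_edges vs)) = 2 * int (length vs) - 2"
    using sum_path_edges[of vs "\<lambda>_. 1::int"] vs ne by (simp add: distinct_card)
  then have c: "card C = length vs"
    using vs closing_edge_notin_path_edges[OF vs(1,2)] by simp
  have "set vs \<subseteq> \<Union>C"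
  proof
    fix v assume "v \<in> set vs"
    then obtain i where i: "i < length vs" "v = vs ! i" by (auto simp: in_set_conv_nth)
    show "v \<in> \<Union>C"
    proof (cases "Suc i < length vs")
      case True
      then have "{vs ! i, vs ! Suc i} \<in> C" using vs by (auto simp: path_edges_conv_nth)
      then show ?thesis using i by blast
    next
      case False
      then have "v = last vs" using i ne by (metis Suc_lessI diff_Suc_1 last_conv_nth)
      moreover have "{last vs, hd vs} \<in> C" using vs(3) by blast
      ultimately show ?thesis by blast
    qed
  qed
  moreover have "\<Union>C \<subseteq> set vs"
    using Union_path_edges_subset[of vs] ne unfolding vs(3) by simp
  ultimately have "\<Union>C = set vs" by blast
  then show ?thesis using that vs c by blast
qed

lemma sum_cycle_edges:
  fixes a :: "'a \<Rightarrow> 'b::comm_ring_1"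
  assumes "is_cycle E C"
  shows "(\<Sum>e\<in>C. sum a e) = 2 * sum a (\<Union>C)"
proof -
  obtain vs where vs: "3 \<le> length vs" "distinct vs" "C = insert {last vs, hd vs} (path_edges vs)"
    "\<Union>C = set vs" using cycle_length_obtain[OF assms] by metis
  have ne: "vs \<noteq> []" using vs by auto
  have ln: "last vs \<noteq> hd vs" using vs ne
    by (auto simp: last_conv_nth hd_conv_nth nth_eq_iff_index_eq)
  show ?thesis
    unfolding vs(4) unfolding vs(3)
    using closing_edge_notin_path_edges[OF vs(1,2)] sum_path_edges[OF vs(2) ne, of a] ln by simp
qed

lemma cycle_finite: "is_cycle E C \<Longrightarrow> finite C \<and> finite (\<Union>C) \<and> C \<noteq> {} \<and> 3 \<le> card C \<and> card (\<Union>C) = card C"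
  by (rule cycle_length_obtain) (auto simp: distinct_card)

lemma cycle_two_neighbours:
  assumes "is_cycle E C" "v \<in> \<Union>C"
  obtains u w where "u \<noteq> w" "u \<noteq> v" "w \<noteq> v" "{v, u} \<in> C" "{v, w} \<in> C"
proof -
  obtain vs where vs: "3 \<le> length vs" "distinct vs" "C = insert {last vs, hd vs} (path_edges vs)"
    "\<Union>C = set vs" using cycle_length_obtain[OF assms(1)] by metis
  have ne: "vs \<noteq> []" using vs by auto
  obtain i where i: "i < length vs" "v = vs ! i" using assms(2) unfolding vs(4) in_set_conv_nth by auto
  have edge: "{vs ! j, vs ! Suc j} \<in> C" if "Suc j < length vs" for j
    using that vs by (auto simp: path_edges_conv_nth)
  have close: "{vs ! (length vs - 1), vs ! 0} \<in> C" using vs ne by (auto simp: last_conv_nth hd_conv_nth)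
  have eq: "vs ! j = vs ! k \<longleftrightarrow> j = k" if "j < length vs" "k < length vs" for j k
    using that vs by (auto simp: nth_eq_iff_index_eq)
  consider "i = 0" | "i > 0" "Suc i < length vs" | "i = length vs - 1" "i > 0"
    using i vs by linarith
  then show ?thesis
  proof cases
    case 1
    then show ?thesis using that[of "vs ! 1" "vs ! (length vs - 1)"] edge[of 0] close i vs eq
      by (auto simp: insert_commute)
  next
    case 2
    then have "{vs ! (i - 1), vs ! i} \<in> C" using edge[of "i - 1"] by auto
    then show ?thesis using that[of "vs ! (i - 1)" "vs ! Suc i"] edge[of i] 2 i eq
      by (auto simp: insert_commute)
  next
    case 3
    then have "Suc (i - 1) = i" by simp
    then have "{vs ! (i - 1), vs ! i} \<in> C" using edge[of "i - 1"] i by metis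
    moreover have "{vs ! i, vs ! 0} \<in> C" using close 3 by simp
    moreover have "vs ! (i - 1) \<noteq> vs ! 0" "vs ! (i - 1) \<noteq> vs ! i" "vs ! 0 \<noteq> vs ! i"
      using eq[of "i - 1" 0] eq[of "i - 1" i] eq[of 0 i] 3 i vs(1) by linarith+
    ultimately show ?thesis using that i(2) by (metis insert_commute)
  qed
qed

section \<open>Leaves of forests and their number of edges\<close>

lemma card_2_obtain:
  assumes "card e = 2" "v \<in> e"
  obtains w where "e = {v, w}" "w \<noteq> v"
  using assms by (auto simp: card_2_iff)

text \<open>In a longest path every neighbour of the first vertex lies on the path; a second edge at
  that vertex therefore closes a cycle.\<close>

lemma min_degree_two_cycle:
  assumes fin: "finite F" and F2: "\<forall>e\<in>F. card e = 2" and ne: "F \<noteq> {}"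
    and deg: "\<And>e v. e \<in> F \<Longrightarrow> v \<in> e \<Longrightarrow> \<exists>e'\<in>F. v \<in> e' \<and> e' \<noteq> e"
  shows "\<exists>C. is_cycle F C"
proof -
  have finV: "finite (\<Union>F)"
    using fin F2 by (metis card.infinite finite_Union zero_neq_numeral)
  let ?P = "\<lambda>vs. distinct vs \<and> 2 \<le> length vs \<and> path_edges vs \<subseteq> F \<and> set vs \<subseteq> \<Union>F"
  obtain e where e: "e \<in> F" using ne by auto
  then obtain x y where xy: "e = {x, y}" "x \<noteq> y" using F2 by (meson card_2_iff)
  have ex: "?P [x, y]" using e xy by auto
  have bd: "\<forall>vs. ?P vs \<longrightarrow> length vs \<le> card (\<Union>F)"
    by (metis card_mono distinct_card finV)
  obtain vs where vs: "?P vs" "\<And>ws. ?P ws \<Longrightarrow> length ws \<le> length vs"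
    using ex_has_greatest_nat[of ?P "[x,y]" length "Suc (card (\<Union>F))"] ex bd by (auto simp: less_Suc_eq_le)
  obtain u v zs where uv: "vs = u # v # zs"
    using vs by (metis Suc_le_length_iff numeral_2_eq_2)
  have "{u, v} \<in> F" using vs uv by auto
  then obtain e' where e': "e' \<in> F" "u \<in> e'" "e' \<noteq> {u, v}" using deg by blast
  then obtain w where w: "e' = {u, w}" "w \<noteq> u" using card_2_obtain F2 by metis
  have "w \<noteq> v" using e' w by auto
  have "w \<in> set vs"
  proof (rule ccontr)
    assume "w \<notin> set vs"
    then have "?P (w # vs)" using vs uv e' w by (auto simp: insert_commute)
    then show False using vs(2) by fastforce
  qed
  then obtain j where j: "j < length vs" "w = vs ! j" by (auto simp: in_set_conv_nth)
  have "j \<noteq> 0" "j \<noteq> 1" using j(2) uv w(2) \<open>w \<noteq> v\<close> by (metis nth_Cons_0, metis One_nat_def nth_Cons_0 nth_Cons_Suc)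
  \<comment> \<open>The prefix from \<open>u\<close> to \<open>w\<close>. Since \<open>w\<close> is
    neither of the first two vertices, it has length at least 3.\<close>
  let ?ws = "take (Suc j) vs"
  have "distinct ?ws" "3 \<le> length ?ws" "path_edges ?ws \<subseteq> F"
    using vs j \<open>j \<noteq> 0\<close> \<open>j \<noteq> 1\<close> path_edges_take_subset[of "Suc j" vs] by auto
  moreover have "last ?ws = w" using j by (simp add: take_Suc_conv_app_nth)
  moreover have "hd ?ws = u" using uv by simp
  moreover have "{w, u} \<in> F" using e' w by (simp add: insert_commute)
  ultimately have "is_cycle F (insert {last ?ws, hd ?ws} (path_edges ?ws))"
    unfolding is_cycle_iff by (metis insert_subset)
  then show ?thesis by blast
qed

lemma forest_leaf:
  assumes "finite F" "\<forall>e\<in>F. card e = 2" "F \<noteq> {}" "is_forest F"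
  obtains e u v where "e \<in> F" "e = {u, v}" "u \<noteq> v" "\<And>e'. e' \<in> F \<Longrightarrow> v \<in> e' \<Longrightarrow> e' = e"
proof -
  obtain e v where ev: "e \<in> F" "v \<in> e" "\<And>e'. e' \<in> F \<Longrightarrow> v \<in> e' \<Longrightarrow> e' = e"
    using min_degree_two_cycle[OF assms(1-3)] assms(4) unfolding is_forest_def by blast
  then obtain u where "e = {u, v}" "u \<noteq> v" using assms(2) card_2_obtain insert_commute by metis
  then show ?thesis using that ev by blast
qed

text \<open>Deleting a leaf removes one edge and one vertex.\<close>

lemma forest_card_less:
  assumes "finite F" "\<forall>e\<in>F. card e = 2" "is_forest F" "finite V" "V \<noteq> {}" "\<Union>F \<subseteq> V"
  shows "card F < card V"
  using assms
proof (induction "card F" arbitrary: F V)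
  case 0
  then show ?case by (simp add: card_gt_0_iff)
next
  case (Suc n)
  then have "F \<noteq> {}" by auto
  then obtain e u v where e: "e \<in> F" "e = {u, v}" "u \<noteq> v" "\<And>e'. e' \<in> F \<Longrightarrow> v \<in> e' \<Longrightarrow> e' = e"
    using forest_leaf Suc.prems by metis
  have uv: "u \<in> V" "v \<in> V" using e Suc.prems by auto
  have "\<Union>(F - {e}) \<subseteq> V - {v}" using Suc.prems e by auto
  moreover have "V - {v} \<noteq> {}" using uv e by auto
  ultimately have "card (F - {e}) < card (V - {v})"
    using Suc e by (intro Suc.hyps(1)) (auto intro: is_forest_mono)
  then show ?case using e uv Suc.prems Suc.hyps(2) by simp
qed

section \<open>Faces of plane drawings\<close>

text \<open>Only edges are recorded: isolated vertices do not affect the faces, and each subset of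
  the edges is again such a drawing.\<close>

locale plane_drawing =
  fixes p :: "'a \<Rightarrow> complex" and \<gamma> :: "'a set \<Rightarrow> real \<Rightarrow> complex" and E :: "'a set set"
  assumes finite_edges: "finite E"
    and edge_card: "\<And>e. e \<in> E \<Longrightarrow> card e = 2"
    and edge_arc: "\<And>e. e \<in> E \<Longrightarrow> arc (\<gamma> e)"
    and edge_ends: "\<And>e. e \<in> E \<Longrightarrow> {pathstart (\<gamma> e), pathfinish (\<gamma> e)} = p ` e"
    and edge_Int: "\<And>e f. e \<in> E \<Longrightarrow> f \<in> E \<Longrightarrow> e \<noteq> f \<Longrightarrow>
      path_image (\<gamma> e) \<inter> path_image (\<gamma> f) = p ` (e \<inter> f)"
begin

lemma restrict_drawing: "E' \<subseteq> E \<Longrightarrow> plane_drawing p \<gamma> E'"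
  by unfold_locales
    (use finite_subset[OF _ finite_edges] edge_card edge_arc edge_ends edge_Int in \<open>simp_all add: subset_iff\<close>)

definition img :: "'a set set \<Rightarrow> complex set" where
  "img F = (\<Union>e\<in>F. path_image (\<gamma> e))"

lemma img_insert: "img (insert e F) = img F \<union> path_image (\<gamma> e)"
  by (auto simp: img_def)

lemma compact_img: "F \<subseteq> E \<Longrightarrow> compact (img F)"
  unfolding img_def using finite_edges edge_arc
  by (intro compact_UN) (auto intro: finite_subset compact_arc_image)

lemma closed_img: "F \<subseteq> E \<Longrightarrow> closed (img F)"
  using compact_img compact_imp_closed by blast

lemma edge_img_Int:
  assumes "e \<in> E" "F \<subseteq> E" "e \<notin> F"
  shows "path_image (\<gamma> e) \<inter> img F = p ` (e \<inter> \<Union>F)"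
proof -
  have "path_image (\<gamma> e) \<inter> img F = (\<Union>f\<in>F. path_image (\<gamma> e) \<inter> path_image (\<gamma> f))"
    by (auto simp: img_def)
  also have "\<dots> = (\<Union>f\<in>F. p ` (e \<inter> f))"
    using assms by (intro SUP_cong edge_Int) auto
  also have "\<dots> = p ` (e \<inter> \<Union>F)" by auto
  finally show ?thesis .
qed

lemma edge_img_Int_ends:
  assumes "e \<in> E" "F \<subseteq> E" "e \<notin> F"
  shows "path_image (\<gamma> e) \<inter> img F \<subseteq> {pathstart (\<gamma> e), pathfinish (\<gamma> e)}"
  unfolding edge_img_Int[OF assms] edge_ends[OF assms(1)] by blast

lemma edge_endpoint: "e \<in> E \<Longrightarrow> v \<in> e \<Longrightarrow> p v \<in> path_image (\<gamma> e)"
  using edge_ends by (metis imageI insertE pathfinish_in_path_image pathstart_in_path_image singletonD)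

text \<open>A leaf edge meets the rest of the drawing in at most one point, so by Janiszewski's
  theorem attaching it keeps the complement connected.\<close>

lemma connected_img_Compl_forest:
  assumes "F \<subseteq> E" "is_forest F"
  shows "connected (- img F)"
proof -
  have "finite F" using assms finite_edges finite_subset by blast
  then show ?thesis using assms
  proof (induction "card F" arbitrary: F)
    case 0
    then show ?case by (simp add: img_def connected_UNIV)
  next
    case (Suc n)
    then have "F \<noteq> {}" "\<forall>e\<in>F. card e = 2" using edge_card by auto
    then obtain e u v where e: "e \<in> F" "e = {u, v}" "u \<noteq> v" "\<And>e'. e' \<in> F \<Longrightarrow> v \<in> e' \<Longrightarrow> e' = e"
      using forest_leaf Suc.prems by metis
    have F: "F - {e} \<subseteq> E" "e \<in> E" using Suc.prems e by auto
    have "connected (- img (F - {e}))"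
      using Suc e F by (intro Suc.hyps(1)) (auto intro: is_forest_mono)
    moreover have "connected (- path_image (\<gamma> e))"
      using edge_arc[OF F(2)] by (intro connected_arc_complement) auto
    moreover have "img (F - {e}) \<inter> path_image (\<gamma> e) \<subseteq> {p u}"
      using edge_img_Int[of e "F - {e}"] F e by blast
    then have "connected (img (F - {e}) \<inter> path_image (\<gamma> e))"
      by (metis connected_empty connected_sing subset_singletonD)
    ultimately have "connected (- (img (F - {e}) \<union> path_image (\<gamma> e)))"
      using compact_img[OF F(1)] edge_arc[OF F(2)]
      by (intro Janiszewski_connected) (auto simp: closed_arc_image)
    then show ?case using e by (metis img_insert insert_Diff)
  qed
qed

text \<open>Provides the set \<open>P\<close> of \<open>components_insert_arc\<close> for an edge
  that closes a cycle. Each edge attached at the head meets the rest of the path in a single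
  point.\<close>

lemma path_edges_img:
  assumes "path_edges vs \<subseteq> E" "distinct vs" "2 \<le> length vs"
  shows "connected (img (path_edges vs))" "connected (- img (path_edges vs))"
    "p (hd vs) \<in> img (path_edges vs)" "p (last vs) \<in> img (path_edges vs)"
proof -
  have "connected (img (path_edges vs)) \<and> connected (- img (path_edges vs)) \<and>
    p (hd vs) \<in> img (path_edges vs) \<and> p (last vs) \<in> img (path_edges vs)"
    using assms
  proof (induction vs rule: path_edges.induct)
    case (1 x y zs)
    let ?F = "path_edges (y # zs)"
    have xyE: "{x, y} \<in> E" "?F \<subseteq> E" using 1 by auto
    have arc: "arc (\<gamma> {x, y})" using edge_arc xyE by blast
    have eq: "img (path_edges (x # y # zs)) = img ?F \<union> path_image (\<gamma> {x, y})"
      by (simp add: img_insert)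
    have xy: "p x \<in> path_image (\<gamma> {x, y})" "p y \<in> path_image (\<gamma> {x, y})"
      using edge_endpoint xyE by auto
    have coA: "connected (path_image (\<gamma> {x, y}))" "connected (- path_image (\<gamma> {x, y}))"
      using arc connected_arc_image connected_arc_complement[OF arc] by auto
    show ?case
    proof (cases zs)
      case Nil
      then show ?thesis using coA xy eq by (simp add: img_def)
    next
      case (Cons z zs')
      have IH: "connected (img ?F)" "connected (- img ?F)" "p y \<in> img ?F" "p (last (y # zs)) \<in> img ?F"
        using 1 Cons by auto
      have "{x, y} \<notin> ?F" "x \<notin> \<Union>?F" using Union_path_edges_subset[of "y # zs"] 1 by auto
      then have "path_image (\<gamma> {x, y}) \<inter> img ?F \<subseteq> {p y}"
        using edge_img_Int[OF xyE(1,2)] by blast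
      then have "connected (img ?F \<inter> path_image (\<gamma> {x, y}))"
        by (metis Int_commute connected_empty connected_sing subset_singletonD)
      then have "connected (- (img ?F \<union> path_image (\<gamma> {x, y})))"
        using compact_img[OF xyE(2)] arc IH coA
        by (intro Janiszewski_connected) (auto simp: closed_arc_image)
      moreover have "connected (img ?F \<union> path_image (\<gamma> {x, y}))"
        by (rule connected_Un) (use IH xy coA in auto)
      ultimately show ?thesis unfolding eq using xy IH by simp
    qed
  qed auto
  then show "connected (img (path_edges vs))" "connected (- img (path_edges vs))"
    "p (hd vs) \<in> img (path_edges vs)" "p (last vs) \<in> img (path_edges vs)" by auto
qed

section \<open>Faces and their boundary edges\<close>

abbreviation faces :: "complex set set" where
  "faces \<equiv> components (- img E)"

text \<open>One interior point is enough: for a face \<open>f\<close>,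
  \<open>arc_in_closure_component\<close> then puts the whole open edge into
  \<open>closure f\<close>. An edge with \<open>f\<close> on both sides is recorded once.\<close>

definition bd :: "complex set \<Rightarrow> 'a set set" where
  "bd f = {e \<in> E. \<exists>s\<in>{0<..<1}. \<gamma> e s \<in> closure f}"

lemma bd_subset: "bd f \<subseteq> E"
  by (auto simp: bd_def)

lemma img_split: "e \<in> E \<Longrightarrow> img E = img (E - {e}) \<union> path_image (\<gamma> e)"
  by (metis img_insert insert_Diff)

lemma bd_at_most_two:
  assumes "f1 \<in> faces" "f2 \<in> faces" "f3 \<in> faces" "e \<in> bd f1" "e \<in> bd f2" "e \<in> bd f3"
    "f1 \<noteq> f3" "f2 \<noteq> f3"
  shows "f1 = f2"
proof -
  have e: "e \<in> E" using assms by (auto simp: bd_def)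
  have eq: "img E = img (E - {e}) \<union> path_image (\<gamma> e)" using img_split[OF e] .
  have sides: "\<exists>s\<in>{0<..<1}. \<gamma> e s \<in> closure f1" "\<exists>s\<in>{0<..<1}. \<gamma> e s \<in> closure f2"
    "\<exists>s\<in>{0<..<1}. \<gamma> e s \<in> closure f3"
    using assms unfolding bd_def by blast+
  have sub: "E - {e} \<subseteq> E" "e \<notin> E - {e}" by auto
  show ?thesis
    using arc_at_most_two_sides[OF compact_img[OF sub(1)] edge_arc[OF e] edge_img_Int_ends[OF e sub]]
      assms(1-3,7,8) sides unfolding eq by blast
qed

lemma face_disjoint_img: "f \<in> faces \<Longrightarrow> f \<inter> img E = {}"
  using in_components_subset by blast

lemma face_nonempty: "f \<in> faces \<Longrightarrow> f \<noteq> {}"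
  using in_components_nonempty by blast

lemma open_face: "f \<in> faces \<Longrightarrow> open f"
  using open_components[of "- img E" f] closed_img[of E] open_Compl by blast

lemma vertices_in_img: "p ` \<Union>E \<subseteq> img E"
  using edge_endpoint by (auto simp: img_def)

text \<open>A frontier point is a vertex or interior to an edge, and in the latter case that edge
  belongs to \<open>bd f\<close>.\<close>

lemma closure_face_subset:
  assumes "f \<in> faces"
  shows "closure f \<subseteq> f \<union> img (bd f) \<union> p ` \<Union>E"
proof
  fix x assume x: "x \<in> closure f"
  show "x \<in> f \<union> img (bd f) \<union> p ` \<Union>E"
  proof (cases "x \<in> f")
    case False
    then have "x \<in> frontier f"
      using x closure_Un_frontier by blast
    then have "x \<in> img E" using frontier_component_Compl_subset[OF closed_img[of E] assms] by auto
    then obtain e where e: "e \<in> E" "x \<in> path_image (\<gamma> e)" by (auto simp: img_def)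
    show ?thesis
    proof (cases "x \<in> p ` e")
      case True
      then show ?thesis using e by blast
    next
      case False
      then have "x \<in> \<gamma> e ` {0<..<1}" using e arc_open_image[OF edge_arc[OF e(1)]] edge_ends[OF e(1)] by auto
      then have "e \<in> bd f" using e x by (auto simp: bd_def)
      then show ?thesis using e by (auto simp: img_def)
    qed
  qed auto
qed

text \<open>Deleting finitely many points from an open connected subset of the plane keeps it
  connected.\<close>

lemma connected_Compl_forest_vertices:
  assumes "F \<subseteq> E" "is_forest F"
  shows "connected (- (img F \<union> p ` \<Union>E))"
proof -
  have "finite (p ` \<Union>E)"
    using finite_edges edge_card by (metis card.infinite finite_Union finite_imageI zero_neq_numeral)
  then have "connected (- img F - p ` \<Union>E)"
    using closed_img[OF assms(1)] connected_img_Compl_forest[OF assms]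
    by (intro connected_open_delete_finite) auto
  then show ?thesis by (simp add: Diff_eq)
qed

lemma edge_interior_not_vertex:
  assumes "e \<in> E" "F \<subseteq> E" "e \<notin> F"
  shows "\<gamma> e (1/2) \<notin> img F \<union> p ` \<Union>E" "\<gamma> e (1/2) \<in> img E"
proof -
  have "\<gamma> e (1/2) \<in> \<gamma> e ` {0<..<1}" by auto
  then have g: "\<gamma> e (1/2) \<in> path_image (\<gamma> e) - p ` e"
    using arc_open_image[OF edge_arc[OF assms(1)]] edge_ends[OF assms(1)] by auto
  then show "\<gamma> e (1/2) \<in> img E" using assms by (auto simp: img_def)
  have "\<gamma> e (1/2) \<notin> img F" using g edge_img_Int[OF assms] by blast
  moreover have "\<gamma> e (1/2) \<noteq> p v" if "f \<in> E" "v \<in> f" for f v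
  proof (cases "f = e")
    case True
    then show ?thesis using g that by blast
  next
    case False
    then have "\<gamma> e (1/2) \<notin> img {f}" using g edge_img_Int[OF assms(1), of "{f}"] that by blast
    then show ?thesis using edge_endpoint[OF that] by (auto simp: img_def)
  qed
  ultimately show "\<gamma> e (1/2) \<notin> img F \<union> p ` \<Union>E" by blast
qed

text \<open>The complement of the forest \<open>bd f\<close> and of all vertices is connected and
  contains no frontier point of \<open>f\<close>, so \<open>f\<close> is all of it. An edge outside
  \<open>bd f\<close> would then have its midpoint in \<open>f\<close>. Contrapositively, in a graph
  with a cycle every face boundary contains one.\<close>

lemma forest_bd_face:
  assumes f: "f \<in> faces" and forest: "is_forest (bd f)"
  shows "is_forest E"
proof -
  define Y where "Y = img (bd f) \<union> p ` \<Union>E"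
  have bdE: "bd f \<subseteq> E" by (rule bd_subset)
  have "img (bd f) \<subseteq> img E" using bdE by (auto simp: img_def)
  then have sub: "f \<subseteq> - Y" using face_disjoint_img[OF f] vertices_in_img unfolding Y_def by blast
  have fr: "- Y \<inter> frontier f = {}"
    using closure_face_subset[OF f, unfolded Un_assoc, folded Y_def] unfolding frontier_def interior_open[OF open_face[OF f]] by blast
  have eq: "f = - Y"
    by (rule clopen_component_eq[OF connected_Compl_forest_vertices[OF bdE forest, folded Y_def] sub face_nonempty[OF f] fr])
  have "e \<in> bd f" if "e \<in> E" for e
    using edge_interior_not_vertex[OF that bdE, folded Y_def] face_disjoint_img[OF f] eq by blast
  then have "bd f = E" using bdE by blast
  then show "is_forest E" using forest by simp
qed

text \<open>Here \<open>f\<close> and \<open>f'\<close> are the two sides of every edge of \<open>C\<close>, so together with the open edges of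
  \<open>C\<close> they form a set which is open and closed in the complement of the remaining boundary.\<close>

lemma two_faces_share_cycle:
  assumes f: "f \<in> faces" "f' \<in> faces" "f \<noteq> f'"
    and C: "C \<subseteq> bd f" "C \<subseteq> bd f'" and forest: "is_forest (bd f \<union> bd f' - C)"
  shows "faces = {f, f'}"
proof -
  define R where "R = bd f \<union> bd f' - C"
  define X where "X = - (img R \<union> p ` \<Union>E)"
  define U where "U = X \<inter> closure (f \<union> f')"
  have CE: "C \<subseteq> E" using C(1) bd_subset by (rule subset_trans)
  have RE: "R \<subseteq> E" using bd_subset[of f] bd_subset[of f'] unfolding R_def by blast
  have conX: "connected X"
    using connected_Compl_forest_vertices[OF RE] forest unfolding X_def R_def by simp
  have "closed (p ` \<Union>E)"
    using finite_edges edge_card by (metis card.infinite finite_Union finite_imageI finite_imp_closed zero_neq_numeral)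
  then have opX: "open X" using closed_img[OF RE] unfolding X_def by (intro open_Compl closed_Un)
  have imgRE: "img R \<subseteq> img E" using RE by (auto simp: img_def)
  have fX: "f \<subseteq> X" "f' \<subseteq> X" using face_disjoint_img f imgRE vertices_in_img unfolding X_def by blast+
  have "open U"
  proof (subst open_contains_ball, intro ballI)
    fix x assume x: "x \<in> U"
    consider "x \<in> f \<union> f'" | "x \<notin> f \<union> f'" by blast
    then show "\<exists>e>0. ball x e \<subseteq> U"
    proof cases
      case 1
      have "f \<union> f' \<subseteq> U" using fX closure_subset unfolding U_def by auto
      moreover have "open (f \<union> f')" using open_face f by blast
      ultimately show ?thesis using 1 by (meson open_contains_ball subset_trans)
    next
      case 2
      then have "x \<in> img (bd f) \<union> img (bd f')" "x \<notin> img R" "x \<notin> p ` \<Union>E"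
        using x closure_face_subset f unfolding U_def X_def by auto
      then obtain e where e: "e \<in> C" "x \<in> path_image (\<gamma> e)" by (auto simp: img_def R_def)
      have eE: "e \<in> E" using e CE by auto
      have arc: "arc (\<gamma> e)" using edge_arc eE by blast
      have "x \<notin> p ` e" using \<open>x \<notin> p ` \<Union>E\<close> eE by blast
      then have "x \<in> \<gamma> e ` {0<..<1}" using e arc_open_image[OF arc] edge_ends[OF eE] by auto
      then obtain s where s: "s \<in> {0<..<1}" "x = \<gamma> e s" by auto
      have clo: "closed (img (E - {e}))" using closed_img[of "E - {e}"] by auto
      have ends: "path_image (\<gamma> e) \<inter> img (E - {e}) \<subseteq> {pathstart (\<gamma> e), pathfinish (\<gamma> e)}"
        using edge_img_Int_ends[OF eE, of "E - {e}"] by auto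
      obtain d where d: "d > 0" "ball x d \<inter> img (E - {e}) = {}" "pathstart (\<gamma> e) \<notin> ball x d"
          "pathfinish (\<gamma> e) \<notin> ball x d"
        using arc_interior_ball[OF clo arc ends s(1)] s(2) by metis
      obtain d' where d': "d' > 0" "ball x d' \<subseteq> X" using opX x unfolding U_def by (meson IntD1 open_contains_ball)
      \<comment> \<open>A point close to \<open>x\<close> but off the edge \<open>e\<close> lies in
        a face bordering \<open>e\<close>, and an edge has at most the two sides \<open>f\<close>
        and \<open>f'\<close>.\<close>
      have cov: "z \<in> f \<union> f'" if z: "z \<in> ball x d" "z \<notin> path_image (\<gamma> e)" for z
      proof -
        have "z \<in> - img E" using z d img_split[OF eE] by blast
        then obtain W where W: "W \<in> faces" "z \<in> W" by (metis Union_components UnionE)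
        have "\<exists>s\<in>{0<..<1}. \<gamma> e s \<in> closure W"
          by (rule component_near_arc_touches[OF clo arc, of "ball x d" x])
            (use d e z W img_split[OF eE] in auto)
        then have "e \<in> bd W" using eE by (auto simp: bd_def)
        then have "W = f \<or> W = f'" using bd_at_most_two[OF f(1,2) W(1)] e C f by blast
        then show ?thesis using W by blast
      qed
      have cl: "y \<in> closure (f \<union> f')" if y: "y \<in> ball x d" for y
      proof (cases "y \<in> path_image (\<gamma> e)")
        case False
        then show ?thesis using cov y closure_subset by blast
      next
        case True
        have "y \<noteq> pathstart (\<gamma> e)" "y \<noteq> pathfinish (\<gamma> e)" using d y by auto
        then have "y \<in> \<gamma> e ` {0<..<1}" using True arc_open_image[OF arc] by auto
        then obtain t where t: "0 < t" "t < 1" "y = \<gamma> e t" by auto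
        have "e \<in> bd f" using e C by blast
        then obtain r where r: "0 < r" "r < 1" "\<gamma> e r \<in> closure f" by (auto simp: bd_def)
        have "y \<in> closure f"
          using arc_in_closure_component[OF compact_img[of "E - {e}"] arc ends, of f r t] f r t img_split[OF eE] by auto
        then show ?thesis by (simp add: closure_Un)
      qed
      have "ball x (min d d') = ball x d \<inter> ball x d'" by auto
      then have "ball x (min d d') \<subseteq> U" using d' cl unfolding U_def by blast
      then show ?thesis using d d' by (meson min_less_iff_conj)
    qed
  qed
  moreover have "closedin (top_of_set X) U" unfolding U_def by (rule closedin_closed_Int[OF closed_closure])
  moreover have "U \<subseteq> X" unfolding U_def by blast
  moreover have "U \<noteq> {}" using fX face_nonempty f closure_subset unfolding U_def by fastforce
  ultimately have "U = X"
    using conX openin_open_eq[OF opX, of U] unfolding connected_clopen by blast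
  show ?thesis
  proof
    show "{f, f'} \<subseteq> faces" using f by auto
    show "faces \<subseteq> {f, f'}"
    proof
      fix W assume W: "W \<in> faces"
      then have "W \<subseteq> X" using face_disjoint_img imgRE vertices_in_img unfolding X_def by blast
      then have "W \<subseteq> closure (f \<union> f')" using \<open>U = X\<close> unfolding U_def by blast
      then have "W \<inter> (f \<union> f') \<noteq> {}"
        using open_Int_closure_eq_empty[OF open_face[OF W], of "f \<union> f'"] face_nonempty[OF W] by blast
      then show "W \<in> {f, f'}" using components_nonoverlap W f by blast
    qed
  qed
qed

lemma face_sides_card:
  "finite {f \<in> faces. e \<in> bd f}" "card {f \<in> faces. e \<in> bd f} \<le> 2"
proof -
  let ?S = "{f \<in> faces. e \<in> bd f}"
  have "\<exists>a b. ?S \<subseteq> {a, b}"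
  proof (cases "\<exists>a b. a \<in> ?S \<and> b \<in> ?S \<and> a \<noteq> b")
    case True
    then obtain a b where ab: "a \<in> ?S" "b \<in> ?S" "a \<noteq> b" by blast
    have "?S \<subseteq> {a, b}"
      using bd_at_most_two ab by blast
    then show ?thesis by blast
  next
    case False
    show ?thesis
    proof (cases "?S = {}")
      case True
      then show ?thesis by (metis empty_subsetI)
    next
      case ne: False
      then obtain a where "a \<in> ?S" by blast
      then have "?S \<subseteq> {a, a}" using False by blast
      then show ?thesis by blast
    qed
  qed
  then obtain a b where ab: "?S \<subseteq> {a, b}" by blast
  then show "finite ?S" by (rule finite_subset) simp
  have "card ?S \<le> card {a, b}" using ab by (intro card_mono) auto
  also have "\<dots> \<le> 2" by (simp add: card_insert_if)
  finally show "card ?S \<le> 2" .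
qed

section \<open>Finiteness of the set of faces and Euler's inequality\<close>

lemma img_Compl_nonempty: "F \<subseteq> E \<Longrightarrow> - img F \<noteq> {}"
  using compact_img[of F] by (metis Compl_empty_eq compact_imp_bounded not_bounded_UNIV double_complement)

text \<open>Unless the graph is a forest, each face has a boundary edge, and an edge borders at most
  two faces. Finiteness makes \<open>card\<close> of the face set meaningful in the counts
  below.\<close>

lemma finite_faces: "finite faces"
proof (cases "is_forest E")
  case True
  then have "faces = {- img E}"
    using connected_img_Compl_forest[of E] img_Compl_nonempty[of E] by (simp add: components_eq_sing_iff)
  then show ?thesis by simp
next
  case False
  have "f \<in> (\<Union>e\<in>E. {f \<in> faces. e \<in> bd f})" if "f \<in> faces" for f
  proof -
    have "bd f \<noteq> {}"
    proof
      assume "bd f = {}"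
      then have "is_forest (bd f)"
        unfolding is_forest_def using is_cycle_subset cycle_finite by (metis subset_empty)
      then show False using forest_bd_face[OF that] False by blast
    qed
    then show ?thesis using that bd_subset by blast
  qed
  then have "faces \<subseteq> (\<Union>e\<in>E. {f \<in> faces. e \<in> bd f})" by blast
  moreover have "finite (\<Union>e\<in>E. {f \<in> faces. e \<in> bd f})"
    using finite_edges face_sides_card(1) by blast
  ultimately show ?thesis by (rule finite_subset)
qed

lemma finite_components_img:
  assumes "F \<subseteq> E"
  shows "finite (components (- img F))"
proof -
  interpret F: plane_drawing p \<gamma> F using restrict_drawing[OF assms] .
  show ?thesis using F.finite_faces .
qed

text \<open>A forest has one face and fewer edges than vertices. Otherwise an edge closing a cycle
  is deleted, which lowers the number of edges by one and that of faces by at least one. For a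
  disconnected graph the inequality is strict.\<close>

lemma euler_inequality_subset:
  assumes "F \<subseteq> E" "finite V" "V \<noteq> {}" "\<Union>F \<subseteq> V"
  shows "card F + 2 \<le> card V + card (components (- img F))"
proof -
  have "finite F" using assms(1) finite_edges finite_subset by blast
  then show ?thesis using assms(1,4)
  proof (induction "card F" arbitrary: F rule: less_induct)
    case less
    show ?case
    proof (cases "is_forest F")
      case True
      then have "components (- img F) = {- img F}"
        using connected_img_Compl_forest[of F] img_Compl_nonempty[of F] less.prems
        by (simp add: components_eq_sing_iff)
      moreover have "card F < card V"
        using less.prems True assms edge_card by (intro forest_card_less) auto
      ultimately show ?thesis by simp
    next
      case False
      then obtain C where C: "is_cycle F C" by (auto simp: is_forest_def)
      then obtain vs where vs: "3 \<le> length vs" "distinct vs" "C = insert {last vs, hd vs} (path_edges vs)"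
        using cycle_length_obtain by metis
      define e where "e = {last vs, hd vs}"
      define F' where "F' = F - {e}"
      have eF: "e \<in> F" using C vs is_cycle_subset unfolding e_def by blast
      have eE: "e \<in> E" "F' \<subseteq> E" "e \<notin> F'" using eF less.prems by (auto simp: F'_def)
      have pF: "path_edges vs \<subseteq> F'"
        using C vs is_cycle_subset closing_edge_notin_path_edges[OF vs(1,2)] unfolding e_def F'_def by blast
      then have pE: "path_edges vs \<subseteq> E" using eE by blast
      have len: "2 \<le> length vs" using vs by simp
      \<comment> \<open>The rest of the cycle is a nonseparating continuum joining the ends of
        \<open>e\<close>, so drawing \<open>e\<close> creates a new component.\<close>
      note P = path_edges_img[OF pE vs(2) len]
      have ends: "pathstart (\<gamma> e) \<in> img (path_edges vs)" "pathfinish (\<gamma> e) \<in> img (path_edges vs)"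
        using edge_ends[OF eE(1)] P(3,4) by (metis e_def image_insert image_empty insert_subset empty_subsetI)+
      have sub: "img (path_edges vs) \<subseteq> img F'" using pF by (auto simp: img_def)
      have eq: "img F = img F' \<union> path_image (\<gamma> e)"
        using eF by (metis F'_def img_insert insert_Diff)
      have "Suc (card (components (- img F'))) \<le> card (components (- img F))"
        unfolding eq
        by (rule components_insert_arc[OF compact_img[OF eE(2)] edge_arc[OF eE(1)] edge_img_Int_ends[OF eE]
              sub compact_img[OF pE] P(1,2) ends])
          (use finite_components_img[OF less.prems(2)] eq in simp)
      moreover have cF: "card F = Suc (card F')"
        using eF less.prems(1) unfolding F'_def by (metis card.remove)
      moreover have "card F' + 2 \<le> card V + card (components (- img F'))"
        using cF less.prems by (intro less.hyps) (auto simp: F'_def)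
      ultimately show ?thesis by linarith
    qed
  qed
qed

text \<open>Read \<open>Y\<close> as edge length. The boundary lengths of all faces sum to at most
  \<open>2 * sum Y E\<close>, and a face with boundary shorter than \<open>M\<close> charges its
  deficit to a cycle in its boundary. The bound \<open>2 * M \<le> 3 * sum Y C\<close> makes this
  charging injective; \<open>card V < card E\<close> yields a cycle and, through Euler's inequality,
  at least three faces.\<close>

lemma weighted_euler_inequality:
  fixes Y :: "'a set \<Rightarrow> int" and M :: int
  assumes V: "finite V" "V \<noteq> {}" "\<Union>E \<subseteq> V" and big: "card V < card E"
    and Y: "\<And>e. e \<in> E \<Longrightarrow> 0 \<le> Y e" and cyc: "\<And>C. is_cycle E C \<Longrightarrow> 2 * M \<le> 3 * sum Y C"
    and M: "0 \<le> M"
  shows "M * (int (card E) + 2 - int (card V)) \<le>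
    2 * sum Y E + (\<Sum>C | is_cycle E C \<and> sum Y C < M. M - sum Y C)"
proof -
  have fin: "finite (bd f)" for f using bd_subset finite_edges finite_subset by blast
  have mono: "sum Y A \<le> sum Y B" if "A \<subseteq> B" "B \<subseteq> E" for A B
    using that Y finite_edges by (intro sum_mono2) (auto intro: finite_subset)
  have euler: "card E + 2 \<le> card V + card faces" using euler_inequality_subset[of E] V by auto
  have noforest: "\<not> is_forest E"
    using forest_card_less[OF finite_edges _ _ V] edge_card big by force
  then have "\<exists>C. is_cycle (bd f) C" if "f \<in> faces" for f
    using forest_bd_face[OF that] unfolding is_forest_def by blast
  then obtain c where c: "\<And>f. f \<in> faces \<Longrightarrow> is_cycle (bd f) (c f)" by metis
  have cE: "is_cycle E (c f)" "c f \<subseteq> bd f" if "f \<in> faces" for f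
    using c[OF that] is_cycle_mono bd_subset is_cycle_subset by blast+
  define D where "D = {f \<in> faces. sum Y (bd f) < M}"
  have inj: "inj_on c D"
  proof (rule inj_onI, rule ccontr)
    fix f f' assume f: "f \<in> D" "f' \<in> D" "c f = c f'" "f \<noteq> f'"
    define C where "C = c f"
    have ff: "f \<in> faces" "f' \<in> faces" using f by (auto simp: D_def)
    have C: "C \<subseteq> bd f" "C \<subseteq> bd f'" "is_cycle E C" using cE ff f(3) unfolding C_def by metis+
    \<comment> \<open>If the remaining boundary were a forest there would be only two faces, but
      there are at least three.\<close>
    have "\<not> is_forest (bd f \<union> bd f' - C)"
    proof
      assume "is_forest (bd f \<union> bd f' - C)"
      then have "faces = {f, f'}" using two_faces_share_cycle[OF ff f(4) C(1,2)] by blast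
      then have "card faces = 2" using f(4) by simp
      then show False using euler big by linarith
    qed
    then obtain D' where D': "is_cycle (bd f \<union> bd f' - C) D'" unfolding is_forest_def by blast
    then have D'sub: "D' \<subseteq> bd f \<union> bd f' - C" by (rule is_cycle_subset)
    moreover have "bd f \<union> bd f' \<subseteq> E" using bd_subset[of f] bd_subset[of f'] by blast
    ultimately have D'E: "is_cycle E D'" using is_cycle_mono[OF D'] by blast
    have finD: "finite D'" "finite C" using cycle_finite D'E C(3) by blast+
    \<comment> \<open>Both boundaries contain \<open>C\<close>, and each edge of \<open>D'\<close>
      is paid by one of them. Together they have length at least
      \<open>2 * sum Y C + sum Y D'\<close>, hence at least \<open>2 * M\<close>, while each is
      shorter than \<open>M\<close>.\<close>
    have "sum Y C + sum Y (D' \<inter> bd f) = sum Y (C \<union> D' \<inter> bd f)"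
      using D'sub finD by (intro sum.union_disjoint[symmetric]) auto
    also have "\<dots> \<le> sum Y (bd f)" using C bd_subset by (intro mono) auto
    finally have 1: "sum Y C + sum Y (D' \<inter> bd f) \<le> sum Y (bd f)" .
    have "sum Y C + sum Y (D' - bd f) = sum Y (C \<union> (D' - bd f))"
      using D'sub finD by (intro sum.union_disjoint[symmetric]) auto
    also have "\<dots> \<le> sum Y (bd f')" using C D'sub bd_subset by (intro mono) auto
    finally have 2: "sum Y C + sum Y (D' - bd f) \<le> sum Y (bd f')" .
    have "sum Y D' = sum Y (D' \<inter> bd f) + sum Y (D' - bd f)"
      using sum.Int_Diff[OF finD(1)] by blast
    moreover have "2 * M \<le> 3 * sum Y C" "2 * M \<le> 3 * sum Y D'" using cyc C D'E by blast+
    moreover have "sum Y (bd f) < M" "sum Y (bd f') < M" using f by (auto simp: D_def)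
    ultimately show False using 1 2 by linarith
  qed
  have finc: "finite {C. is_cycle E C \<and> sum Y C < M}"
    by (rule finite_subset[of _ "Pow E"]) (auto simp: finite_edges dest: is_cycle_subset)
  have finD: "finite D" using finite_faces by (auto simp: D_def)
  have deficit: "(\<Sum>f\<in>D. M - sum Y (bd f)) \<le> (\<Sum>C | is_cycle E C \<and> sum Y C < M. M - sum Y C)"
  proof -
    have le: "sum Y (c f) \<le> sum Y (bd f)" if "f \<in> D" for f
      using mono[OF cE(2) bd_subset] that by (auto simp: D_def)
    have "(\<Sum>f\<in>D. M - sum Y (bd f)) \<le> (\<Sum>f\<in>D. M - sum Y (c f))"
      using le by (intro sum_mono) auto
    also have "\<dots> = (\<Sum>C\<in>c ` D. M - sum Y C)" by (simp only: sum.reindex[OF inj] o_def)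
    also have "\<dots> \<le> (\<Sum>C | is_cycle E C \<and> sum Y C < M. M - sum Y C)"
    proof (rule sum_mono2[OF finc])
      show "c ` D \<subseteq> {C. is_cycle E C \<and> sum Y C < M}" using le cE(1) by (force simp: D_def)
    qed auto
    finally show ?thesis .
  qed
  have bdY: "sum Y (bd f) = (\<Sum>e\<in>E. if e \<in> bd f then Y e else 0)" for f
  proof -
    have "E \<inter> bd f = bd f" using bd_subset by blast
    then show ?thesis using sum.inter_restrict[OF finite_edges, of Y "bd f"] by simp
  qed
  have "(\<Sum>f\<in>faces. sum Y (bd f)) = (\<Sum>f\<in>faces. \<Sum>e\<in>E. if e \<in> bd f then Y e else 0)"
    unfolding bdY ..
  also have "\<dots> = (\<Sum>e\<in>E. \<Sum>f\<in>faces. if e \<in> bd f then Y e else 0)" by (rule sum.swap)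
  also have "\<dots> \<le> (\<Sum>e\<in>E. 2 * Y e)"
  proof (rule sum_mono)
    fix e assume e: "e \<in> E"
    have "(\<Sum>f\<in>faces. if e \<in> bd f then Y e else 0) = int (card {f \<in> faces. e \<in> bd f}) * Y e"
      using finite_faces by (simp add: sum.If_cases Int_def)
    also have "\<dots> \<le> 2 * Y e" using face_sides_card(2)[of e] Y[OF e] by (intro mult_right_mono) auto
    finally show "(\<Sum>f\<in>faces. if e \<in> bd f then Y e else 0) \<le> 2 * Y e" .
  qed
  finally have total: "(\<Sum>f\<in>faces. sum Y (bd f)) \<le> 2 * sum Y E" by (simp add: sum_distrib_left)
  have "M * int (card faces) = (\<Sum>f\<in>faces. M)" by simp
  also have "\<dots> \<le> (\<Sum>f\<in>faces. sum Y (bd f) + (if f \<in> D then M - sum Y (bd f) else 0))"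
    by (intro sum_mono) (auto simp: D_def)
  also have "\<dots> = (\<Sum>f\<in>faces. sum Y (bd f)) + (\<Sum>f\<in>D. M - sum Y (bd f))"
  proof -
    have "(\<Sum>f\<in>faces. if f \<in> D then M - sum Y (bd f) else 0) = (\<Sum>f\<in>faces \<inter> D. M - sum Y (bd f))"
      by (rule sum.inter_restrict[OF finite_faces, symmetric])
    moreover have "faces \<inter> D = D" by (auto simp: D_def)
    ultimately show ?thesis by (simp add: sum.distrib)
  qed
  finally have "M * int (card faces) \<le> 2 * sum Y E + (\<Sum>C | is_cycle E C \<and> sum Y C < M. M - sum Y C)"
    using total deficit by linarith
  moreover have "M * (int (card E) + 2 - int (card V)) \<le> M * int (card faces)"
    using euler M by (intro mult_left_mono) auto
  ultimately show ?thesis by linarith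
qed

end

section \<open>Discharging\<close>

definition degree_in :: "'a set set \<Rightarrow> 'a \<Rightarrow> nat" where
  "degree_in E v = card {e \<in> E. v \<in> e}"

lemma sum_degree_in:
  fixes a :: "'a \<Rightarrow> int"
  assumes "finite V" "finite E" "\<And>e. e \<in> E \<Longrightarrow> e \<subseteq> V"
  shows "(\<Sum>e\<in>E. sum a e) = (\<Sum>v\<in>V. int (degree_in E v) * a v)"
proof -
  have "(\<Sum>e\<in>E. sum a e) = (\<Sum>e\<in>E. \<Sum>v\<in>V. if v \<in> e then a v else 0)"
  proof (rule sum.cong[OF refl])
    fix e assume "e \<in> E"
    then have "V \<inter> e = e" using assms(3) by blast
    then show "sum a e = (\<Sum>v\<in>V. if v \<in> e then a v else 0)"
      using sum.inter_restrict[OF assms(1), of a e] by simp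
  qed
  also have "\<dots> = (\<Sum>v\<in>V. \<Sum>e\<in>E. if v \<in> e then a v else 0)" by (rule sum.swap)
  also have "\<dots> = (\<Sum>v\<in>V. int (degree_in E v) * a v)"
    using assms(2) by (intro sum.cong) (auto simp: degree_in_def sum.If_cases Int_def)
  finally show ?thesis .
qed

text \<open>The values keep \<open>d * wt d \<ge> 72\<close> for \<open>d \<ge> 2\<close>, with
  equality at 2 and 3, yet adjacent weights sum to at most 48 under the assumptions of
  \<open>discharging\<close>. Degrees 0 and 1 share the first value but are excluded there by
  \<open>min2\<close>.\<close>

definition wt :: "nat \<Rightarrow> int" where
  "wt d = (if d \<le> 2 then 36 else if d = 3 then 24 else if d = 4 then 20 else if d \<le> 6 then 15 else 12)"

definition surplus :: "nat \<Rightarrow> int" where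
  "surplus d = int d * wt d - 72"

lemma wt_cases:
  assumes "2 \<le> d"
  shows "d = 2 \<and> wt d = 36 \<or> d = 3 \<and> wt d = 24 \<or> d = 4 \<and> wt d = 20 \<or>
    5 \<le> d \<and> d \<le> 6 \<and> wt d = 15 \<or> 7 \<le> d \<and> wt d = 12"
  using assms by (auto simp: wt_def)

text \<open>This difference decides the short cycles: on a cycle of length \<open>n\<close>, twice
  the surplus of the vertices covers the deficit \<open>144 - sum Y C\<close> iff the differences
  sum to at most \<open>36 * (n - 2)\<close>. The jumps between 5 and 6 and between 7 and 8 are
  behind the degree bounds in \<open>R3t\<close>.\<close>

lemma wt_minus_surplus_cases:
  assumes "2 \<le> d"
  shows "d = 2 \<and> wt d - surplus d = 36 \<or> d = 3 \<and> wt d - surplus d = 24 \<or>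
    4 \<le> d \<and> d \<le> 5 \<and> wt d - surplus d = 12 \<or> 6 \<le> d \<and> d \<le> 7 \<and> wt d - surplus d \<le> 0 \<or>
    8 \<le> d \<and> wt d - surplus d \<le> -12"
  using assms by (auto simp: wt_def surplus_def)

lemma surplus_nonneg: "2 \<le> d \<Longrightarrow> 0 \<le> surplus d"
  by (auto simp: wt_def surplus_def)

text \<open>The trace of \<open>R2\<close> and \<open>R3\<close> on the weights of three consecutive
  vertices, \<open>c\<close> in the middle. With degrees eliminated, the bound for 5-cycles becomes
  pure linear arithmetic.\<close>

definition wt_triple :: "int \<Rightarrow> int \<Rightarrow> int \<Rightarrow> bool" where
  "wt_triple l c r \<longleftrightarrow> c = 36 \<and> l = 12 \<and> r = 12 \<or>
     c = 24 \<and> (l \<le> 15 \<and> r \<le> 15 \<or> l \<le> 24 \<and> r = 12 \<or> r \<le> 24 \<and> l = 12) \<or> c \<le> 20"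

text \<open>The value 108 is chosen for \<open>72 * 5 - 2 * 108 = 144\<close>. It is attained by the
  weights 24, 24, 12, 36, 12.\<close>

lemma wt_triple_five_cycle:
  assumes "wt_triple v w x" "wt_triple w x y" "wt_triple x y z" "wt_triple y z v" "wt_triple z v w"
  shows "v + w + x + y + z \<le> 108"
  using assms unfolding wt_triple_def by (smt (verit))

text \<open>The assumptions say that no reducible configuration occurs.\<close>

locale discharging = plane_drawing p \<gamma> E for p :: "'a \<Rightarrow> complex" and \<gamma> E +
  fixes V :: "'a set"
  assumes finV: "finite V" and neV: "V \<noteq> {}" and EV: "\<And>e. e \<in> E \<Longrightarrow> e \<subseteq> V"
    and min2: "\<And>v. v \<in> V \<Longrightarrow> 2 \<le> degree_in E v"
    and R2: "\<And>v w. {v, w} \<in> E \<Longrightarrow> degree_in E v = 2 \<Longrightarrow> 7 \<le> degree_in E w"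
    and R3: "\<And>v a b. {v, a} \<in> E \<Longrightarrow> {v, b} \<in> E \<Longrightarrow> a \<noteq> b \<Longrightarrow> degree_in E v = 3 \<Longrightarrow>
      degree_in E a \<le> 4 \<Longrightarrow> 7 \<le> degree_in E b"
    and R3t: "\<And>v a b. {v, a} \<in> E \<Longrightarrow> {v, b} \<in> E \<Longrightarrow> {a, b} \<in> E \<Longrightarrow> degree_in E v = 3 \<Longrightarrow>
      degree_in E a \<le> 5 \<Longrightarrow> 8 \<le> degree_in E b"
    and indep: "\<And>C D. is_cycle E C \<Longrightarrow> is_cycle E D \<Longrightarrow> C \<noteq> D \<Longrightarrow>
           card C \<le> 4 \<Longrightarrow> card D \<le> 4 \<Longrightarrow> independent_cycles C D"
begin

abbreviation d :: "'a \<Rightarrow> nat" where "d \<equiv> degree_in E"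

lemma edge_min2: "{u, v} \<in> E \<Longrightarrow> 2 \<le> d u" "{u, v} \<in> E \<Longrightarrow> 2 \<le> d v"
  using EV[of "{u, v}"] min2 by auto

text \<open>Only weight 36 could break the bound, and \<open>R2\<close> pairs it with 12; elsewhere
  weights are at most 24. Each edge thus has length at least \<open>72 - 48 = 24\<close>, and six
  edges reach 144.\<close>

lemma edge_wt: "{u, v} \<in> E \<Longrightarrow> wt (d u) + wt (d v) \<le> 48"
  using edge_min2[of u v] wt_cases[of "d u"] wt_cases[of "d v"] R2[of u v] R2[of v u]
  by (auto simp: insert_commute)

lemma path_wt_triple:
  assumes "{u, v} \<in> E" "{v, w} \<in> E" "u \<noteq> w"
  shows "wt_triple (wt (d u)) (wt (d v)) (wt (d w))"
proof -
  have 1: "2 \<le> d u" "2 \<le> d v" "2 \<le> d w" using edge_min2 assms by blast+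
  have E': "{v, u} \<in> E" "{w, v} \<in> E" using assms by (simp_all add: insert_commute)
  have 2: "d v = 2 \<Longrightarrow> 7 \<le> d u \<and> 7 \<le> d w" using R2 E' assms by blast
  have 3: "d v = 3 \<Longrightarrow> d u \<le> 4 \<Longrightarrow> 7 \<le> d w" "d v = 3 \<Longrightarrow> d w \<le> 4 \<Longrightarrow> 7 \<le> d u"
    using R3[OF E'(1) assms(2,3)] R3[OF assms(2) E'(1) assms(3)[symmetric]] by blast+
  have 4: "d u = 2 \<Longrightarrow> 7 \<le> d v" "d w = 2 \<Longrightarrow> 7 \<le> d v" using R2 E' assms by blast+
  show ?thesis unfolding wt_triple_def
    using wt_cases[OF 1(1)] wt_cases[OF 1(2)] wt_cases[OF 1(3)] 2 3 4
    by (elim disjE conjE) simp_all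
qed

text \<open>The first bound makes a triangle at least \<open>216 - 120 = 96\<close> long, two thirds
  of 144. The second is \<open>36 * (n - 2)\<close> for \<open>n = 3\<close>: the surplus of the
  vertices pays the deficit.\<close>

lemma triangle_wt:
  assumes E3: "{x, y} \<in> E" "{y, z} \<in> E" "{z, x} \<in> E" and "x \<noteq> y" "y \<noteq> z" "z \<noteq> x"
  shows "wt (d x) + wt (d y) + wt (d z) \<le> 60"
    and "(wt (d x) - surplus (d x)) + (wt (d y) - surplus (d y)) + (wt (d z) - surplus (d z)) \<le> 36"
proof -
  have 1: "2 \<le> d x" "2 \<le> d y" "2 \<le> d z" using edge_min2 assms by blast+
  have E3': "{y, x} \<in> E" "{z, y} \<in> E" "{x, z} \<in> E" using E3 by (simp_all add: insert_commute)
  have 2: "d x = 2 \<Longrightarrow> 7 \<le> d y \<and> 7 \<le> d z" "d y = 2 \<Longrightarrow> 7 \<le> d x \<and> 7 \<le> d z" "d z = 2 \<Longrightarrow> 7 \<le> d x \<and> 7 \<le> d y"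
    using R2 E3 E3' by blast+
  have 3: "d x = 3 \<Longrightarrow> d y \<le> 5 \<Longrightarrow> 8 \<le> d z" "d x = 3 \<Longrightarrow> d z \<le> 5 \<Longrightarrow> 8 \<le> d y"
     "d y = 3 \<Longrightarrow> d x \<le> 5 \<Longrightarrow> 8 \<le> d z" "d y = 3 \<Longrightarrow> d z \<le> 5 \<Longrightarrow> 8 \<le> d x"
     "d z = 3 \<Longrightarrow> d x \<le> 5 \<Longrightarrow> 8 \<le> d y" "d z = 3 \<Longrightarrow> d y \<le> 5 \<Longrightarrow> 8 \<le> d x"
    using R3t E3 E3' by blast+
  show "wt (d x) + wt (d y) + wt (d z) \<le> 60"
    using wt_cases[OF 1(1)] wt_cases[OF 1(2)] wt_cases[OF 1(3)] 2 3
    by (elim disjE conjE) simp_all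
  show "(wt (d x) - surplus (d x)) + (wt (d y) - surplus (d y)) + (wt (d z) - surplus (d z)) \<le> 36"
    using wt_minus_surplus_cases[OF 1(1)] wt_minus_surplus_cases[OF 1(2)] wt_minus_surplus_cases[OF 1(3)] 2 3
    by (elim disjE conjE) simp_all
qed

text \<open>The bound is \<open>36 * (n - 2)\<close> for \<open>n = 4\<close>. \<open>R3\<close>
  applies at each vertex because its two neighbours, opposite on the cycle, are distinct.\<close>

lemma four_cycle_wt:
  assumes E4: "{x, y} \<in> E" "{y, z} \<in> E" "{z, w} \<in> E" "{w, x} \<in> E" and ne: "x \<noteq> z" "y \<noteq> w"
  shows "(wt (d x) - surplus (d x)) + (wt (d y) - surplus (d y)) + (wt (d z) - surplus (d z)) +
    (wt (d w) - surplus (d w)) \<le> 72"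
proof -
  have 1: "2 \<le> d x" "2 \<le> d y" "2 \<le> d z" "2 \<le> d w" using edge_min2 assms by blast+
  have E4': "{y, x} \<in> E" "{z, y} \<in> E" "{w, z} \<in> E" "{x, w} \<in> E" using E4 by (simp_all add: insert_commute)
  have ne': "z \<noteq> x" "w \<noteq> y" using ne by auto
  have 2: "d x = 2 \<Longrightarrow> 7 \<le> d y \<and> 7 \<le> d w" "d y = 2 \<Longrightarrow> 7 \<le> d x \<and> 7 \<le> d z"
    "d z = 2 \<Longrightarrow> 7 \<le> d y \<and> 7 \<le> d w" "d w = 2 \<Longrightarrow> 7 \<le> d x \<and> 7 \<le> d z"
    using R2 E4 E4' by blast+
  have 3: "d x = 3 \<Longrightarrow> d y \<le> 4 \<Longrightarrow> 7 \<le> d w" "d x = 3 \<Longrightarrow> d w \<le> 4 \<Longrightarrow> 7 \<le> d y"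
    "d y = 3 \<Longrightarrow> d x \<le> 4 \<Longrightarrow> 7 \<le> d z" "d y = 3 \<Longrightarrow> d z \<le> 4 \<Longrightarrow> 7 \<le> d x"
    "d z = 3 \<Longrightarrow> d y \<le> 4 \<Longrightarrow> 7 \<le> d w" "d z = 3 \<Longrightarrow> d w \<le> 4 \<Longrightarrow> 7 \<le> d y"
    "d w = 3 \<Longrightarrow> d x \<le> 4 \<Longrightarrow> 7 \<le> d z" "d w = 3 \<Longrightarrow> d z \<le> 4 \<Longrightarrow> 7 \<le> d x"
    using R3[OF E4(1) E4'(4) ne(2)] R3[OF E4'(4) E4(1) ne'(2)] R3[OF E4'(1) E4(2) ne(1)] R3[OF E4(2) E4'(1) ne'(1)]
      R3[OF E4'(2) E4(3) ne(2)] R3[OF E4(3) E4'(2) ne'(2)] R3[OF E4(4) E4'(3) ne(1)] R3[OF E4'(3) E4(4) ne'(1)]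
    by blast+
  show ?thesis
    using wt_minus_surplus_cases[OF 1(1)] wt_minus_surplus_cases[OF 1(2)]
      wt_minus_surplus_cases[OF 1(3)] wt_minus_surplus_cases[OF 1(4)] 2 3
    by (elim disjE conjE) simp_all
qed

section \<open>Edge lengths and bounds on cycle lengths\<close>

definition Y :: "'a set \<Rightarrow> int" where "Y e = 72 - (\<Sum>v\<in>e. wt (d v))"

lemma Y_ge: "e \<in> E \<Longrightarrow> 24 \<le> Y e"
proof -
  assume e: "e \<in> E"
  then obtain u v where "e = {u, v}" "u \<noteq> v" using edge_card by (meson card_2_iff)
  then show ?thesis using edge_wt[of u v] e by (simp add: Y_def)
qed

lemma Y_cycle: "is_cycle E C \<Longrightarrow> sum Y C = 72 * int (card C) - 2 * (\<Sum>v\<in>\<Union>C. wt (d v))"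
  using sum_cycle_edges[of E C "\<lambda>v. wt (d v)"] by (simp add: Y_def sum_subtractf)

lemma Y_cycle_ge: "is_cycle E C \<Longrightarrow> 24 * int (card C) \<le> sum Y C"
  using sum_mono[of C "\<lambda>_. 24" Y] Y_ge is_cycle_subset[of E C] by (auto simp: mult.commute)

lemma list_of_length:
  "length vs = 3 \<Longrightarrow> \<exists>x y z. vs = [x, y, z]"
  "length vs = 4 \<Longrightarrow> \<exists>x y z w. vs = [x, y, z, w]"
  "length vs = 5 \<Longrightarrow> \<exists>x y z w v. vs = [x, y, z, w, v]"
  by (auto simp: length_Suc_conv eval_nat_numeral)

text \<open>Lengths 3 and 4 use the two preceding weight bounds; a 5-cycle has length at least
  \<open>360 - 2 * 108 = 144\<close>, and six or more edges at least \<open>6 * 24 = 144\<close>.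
  The value 288 is \<open>2 * M\<close> for \<open>M = 144\<close> in
  \<open>weighted_euler_inequality\<close>.\<close>

lemma cycle_bounds:
  assumes C: "is_cycle E C"
  shows "288 \<le> 3 * sum Y C"
    and "sum Y C < 144 \<Longrightarrow> card C \<le> 4"
    and "card C \<le> 4 \<Longrightarrow> 144 - sum Y C \<le> 2 * (\<Sum>v\<in>\<Union>C. surplus (d v))"
proof -
  obtain vs where vs: "3 \<le> length vs" "distinct vs" "C = insert {last vs, hd vs} (path_edges vs)"
    "card C = length vs" "\<Union>C = set vs" using cycle_length_obtain[OF C] by metis
  have CE: "C \<subseteq> E" using is_cycle_subset[OF C] .
  have Y: "sum Y C = 72 * int (length vs) - 2 * (\<Sum>v\<in>set vs. wt (d v))" using Y_cycle[OF C] vs(4,5) by simp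
  have Yg: "24 * int (length vs) \<le> sum Y C" using Y_cycle_ge[OF C] vs(4) by simp
  consider "length vs = 3" | "length vs = 4" | "length vs = 5" | "6 \<le> length vs" using vs(1) by linarith
  then have "288 \<le> 3 * sum Y C \<and> (sum Y C < 144 \<longrightarrow> card C \<le> 4) \<and>
    (card C \<le> 4 \<longrightarrow> 144 - sum Y C \<le> 2 * (\<Sum>v\<in>\<Union>C. surplus (d v)))"
  proof cases
    case 1
    then obtain x y z where xyz: "vs = [x, y, z]" using list_of_length(1)[of vs] by blast
    have "{x, y} \<in> E" "{y, z} \<in> E" "{z, x} \<in> E" using vs(3) CE xyz by auto
    then show ?thesis using triangle_wt[of x y z] vs(2,4,5) xyz Y by auto
  next
    case 2
    then obtain x y z w where xyz: "vs = [x, y, z, w]" using list_of_length(2)[of vs] by blast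
    have "{x, y} \<in> E" "{y, z} \<in> E" "{z, w} \<in> E" "{w, x} \<in> E" using vs(3) CE xyz by auto
    then show ?thesis using four_cycle_wt[of x y z w] vs(2,4,5) xyz Y Yg by auto
  next
    case 3
    then obtain x y z w v where xyz: "vs = [x, y, z, w, v]" using list_of_length(3)[of vs] by blast
    have e: "{x, y} \<in> E" "{y, z} \<in> E" "{z, w} \<in> E" "{w, v} \<in> E" "{v, x} \<in> E" using vs(3) CE xyz by auto
    have "wt (d x) + wt (d y) + wt (d z) + wt (d w) + wt (d v) \<le> 108"
      using path_wt_triple[OF e(1,2)] path_wt_triple[OF e(2,3)] path_wt_triple[OF e(3,4)]
        path_wt_triple[OF e(4,5)] path_wt_triple[OF e(5,1)] vs(2) unfolding xyz
      by (intro wt_triple_five_cycle) auto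
    then show ?thesis using vs(2,4,5) xyz Y by auto
  next
    case 4
    then show ?thesis using Yg vs(4) by auto
  qed
  then show "288 \<le> 3 * sum Y C" "sum Y C < 144 \<Longrightarrow> card C \<le> 4"
    "card C \<le> 4 \<Longrightarrow> 144 - sum Y C \<le> 2 * (\<Sum>v\<in>\<Union>C. surplus (d v))" by auto
qed

lemma contradiction: False
proof -
  let ?S = "{C. is_cycle E C \<and> sum Y C < 144}"
  let ?T = "\<Sum>v\<in>V. int (d v) * wt (d v)"
  have UE: "\<Union>E \<subseteq> V" using EV by blast
  have n0: "0 < card V" using finV neV by (simp add: card_gt_0_iff)
  have sums: "(\<Sum>e\<in>E. \<Sum>v\<in>e. wt (d v)) = ?T"
    using sum_degree_in[OF finV finite_edges EV, of "\<lambda>v. wt (d v)"] by simp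
  have YE: "sum Y E = 72 * int (card E) - ?T"
    using sums by (simp add: Y_def sum_subtractf)
  have surp: "(\<Sum>v\<in>V. surplus (d v)) = ?T - 72 * int (card V)"
    by (simp add: surplus_def sum_subtractf)
  then have T: "72 * int (card V) \<le> ?T" using sum_nonneg[of V "\<lambda>v. surplus (d v)"] surplus_nonneg[OF min2] by simp
  have "24 * int (card E) \<le> sum Y E"
    using sum_mono[of E "\<lambda>_. 24" Y] Y_ge by (auto simp: mult.commute)
  \<comment> \<open>Combining \<open>24 * |E| \<le> 72 * |E| - ?T\<close> with
    \<open>72 * |V| \<le> ?T\<close> gives \<open>48 * |E| \<ge> 72 * |V|\<close>, where
    \<open>|V| > 0\<close>.\<close>
  then have big: "card V < card E" using YE T n0 by linarith
  have "144 * (int (card E) + 2 - int (card V)) \<le> 2 * sum Y E + (\<Sum>C\<in>?S. 144 - sum Y C)"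
    using Y_ge cycle_bounds(1) by (intro weighted_euler_inequality finV neV UE big) force+
  moreover have "(\<Sum>C\<in>?S. 144 - sum Y C) \<le> 2 * (\<Sum>v\<in>V. surplus (d v))"
  proof -
    have fin: "finite ?S"
      by (rule finite_subset[of _ "Pow E"]) (auto simp: finite_edges dest: is_cycle_subset)
    have "(\<Sum>C\<in>?S. 144 - sum Y C) \<le> (\<Sum>C\<in>?S. 2 * (\<Sum>v\<in>\<Union>C. surplus (d v)))"
      using cycle_bounds by (intro sum_mono) auto
    also have "\<dots> = 2 * (\<Sum>C\<in>?S. \<Sum>v\<in>\<Union>C. surplus (d v))" by (simp add: sum_distrib_left)
    \<comment> \<open>A cycle shorter than 144 has at most four edges, so these cycles are pairwise
      disjoint and no vertex pays twice.\<close>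
    also have "(\<Sum>C\<in>?S. \<Sum>v\<in>\<Union>C. surplus (d v)) = (\<Sum>v\<in>(\<Union>C\<in>?S. \<Union>C). surplus (d v))"
    proof (rule sum.UNION_disjoint[OF fin, symmetric])
      show "\<forall>C\<in>?S. finite (\<Union>C)" using cycle_finite by blast
      show "\<forall>C\<in>?S. \<forall>D\<in>?S. C \<noteq> D \<longrightarrow> \<Union>C \<inter> \<Union>D = {}"
        using indep cycle_bounds(2) unfolding independent_cycles_def by blast
    qed
    also have "\<dots> \<le> (\<Sum>v\<in>V. surplus (d v))"
      using UE surplus_nonneg[OF min2] finV by (intro sum_mono2) (auto dest!: is_cycle_subset)
    finally show ?thesis by simp
  qed
  ultimately have "144 * (int (card E) + 2 - int (card V)) \<le> 2 * sum Y E + 2 * (\<Sum>v\<in>V. surplus (d v))"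
    by (rule order_trans[OF _ add_left_mono])
  \<comment> \<open>\<open>?T\<close> cancels: the right side becomes
    \<open>144 * (|E| - |V|)\<close>, and the left side exceeds it by 288.\<close>
  then show False unfolding YE surp by (simp add: algebra_simps)
qed

end

section \<open>Equitable tree colorings\<close>

definition nbrs :: "'a set set \<Rightarrow> 'a \<Rightarrow> 'a set" where
  "nbrs E v = {u. {v, u} \<in> E}"

text \<open>The hypotheses of the theorem, bundled as a property that passes to induced subgraphs,
  as the colouring induction requires.\<close>

definition sparse_planar :: "'a set \<Rightarrow> 'a set set \<Rightarrow> bool" where
  "sparse_planar V E \<longleftrightarrow> simple_graph V E \<and> planar_graph V E \<and>
     (\<forall>C D. is_cycle E C \<longrightarrow> is_cycle E D \<longrightarrow> C \<noteq> D \<longrightarrow> card C \<le> 4 \<longrightarrow> card D \<le> 4 \<longrightarrow>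
        independent_cycles C D)"

lemma simple_graph_finite:
  assumes "simple_graph V E"
  shows "finite V" "finite E" "\<And>e. e \<in> E \<Longrightarrow> e \<subseteq> V" "\<And>e. e \<in> E \<Longrightarrow> card e = 2"
proof -
  show V: "finite V" "\<And>e. e \<in> E \<Longrightarrow> e \<subseteq> V" "\<And>e. e \<in> E \<Longrightarrow> card e = 2"
    using assms by (auto simp: simple_graph_def)
  then show "finite E" by (meson PowI finite_Pow_iff finite_subset subsetI)
qed

lemma simple_graph_edge:
  assumes "simple_graph V E" "{u, v} \<in> E"
  shows "u \<in> V" "v \<in> V" "u \<noteq> v"
proof -
  show "u \<in> V" "v \<in> V" using simple_graph_finite(3)[OF assms] by auto
  show "u \<noteq> v" using simple_graph_finite(4)[OF assms] by auto
qed

lemma nbrs_subset: "simple_graph V E \<Longrightarrow> nbrs E v \<subseteq> V"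
  using simple_graph_edge by (auto simp: nbrs_def)

lemma finite_nbrs: "simple_graph V E \<Longrightarrow> finite (nbrs E v)"
  using nbrs_subset simple_graph_finite(1) finite_subset by metis

lemma degree_in_eq_card_nbrs:
  assumes "simple_graph V E"
  shows "degree_in E v = card (nbrs E v)"
proof -
  have "{e \<in> E. v \<in> e} = (\<lambda>u. {v, u}) ` nbrs E v"
  proof
    show "{e \<in> E. v \<in> e} \<subseteq> (\<lambda>u. {v, u}) ` nbrs E v"
    proof
      fix e assume e: "e \<in> {e \<in> E. v \<in> e}"
      then obtain w where "e = {v, w}" using card_2_obtain simple_graph_finite(4)[OF assms] by (metis (no_types, lifting) mem_Collect_eq)
      then show "e \<in> (\<lambda>u. {v, u}) ` nbrs E v" using e by (auto simp: nbrs_def)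
    qed
  qed (auto simp: nbrs_def)
  moreover have "inj_on (\<lambda>u. {v, u}) (nbrs E v)" by (auto simp: inj_on_def doubleton_eq_iff)
  ultimately show ?thesis by (simp add: degree_in_def card_image)
qed

lemma induced_edges_subset: "induced_edges E S \<subseteq> E"
  by (auto simp: induced_edges_def)

lemma nbrs_induced: "v \<in> S \<Longrightarrow> nbrs (induced_edges E S) v = nbrs E v \<inter> S"
  by (auto simp: nbrs_def induced_edges_def)

definition is_drawing :: "'a set \<Rightarrow> 'a set set \<Rightarrow> ('a \<Rightarrow> complex) \<Rightarrow> ('a set \<Rightarrow> real \<Rightarrow> complex) \<Rightarrow> bool" where
  "is_drawing V E p \<gamma> \<longleftrightarrow> inj_on p V \<and>
     (\<forall>e\<in>E. arc (\<gamma> e) \<and> {pathstart (\<gamma> e), pathfinish (\<gamma> e)} = p ` e \<and>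
        path_image (\<gamma> e) \<inter> p ` V = p ` e) \<and>
     (\<forall>e\<in>E. \<forall>f\<in>E. e \<noteq> f \<longrightarrow> path_image (\<gamma> e) \<inter> path_image (\<gamma> f) = p ` (e \<inter> f))"

lemma planar_graph_iff_drawing: "planar_graph V E \<longleftrightarrow> (\<exists>p \<gamma>. is_drawing V E p \<gamma>)"
  unfolding planar_graph_def is_drawing_def ..

lemma is_drawingD:
  assumes "is_drawing V E p \<gamma>"
  shows "inj_on p V" "e \<in> E \<Longrightarrow> arc (\<gamma> e)"
    "e \<in> E \<Longrightarrow> {pathstart (\<gamma> e), pathfinish (\<gamma> e)} = p ` e"
    "e \<in> E \<Longrightarrow> path_image (\<gamma> e) \<inter> p ` V = p ` e"
    "e \<in> E \<Longrightarrow> f \<in> E \<Longrightarrow> e \<noteq> f \<Longrightarrow> path_image (\<gamma> e) \<inter> path_image (\<gamma> f) = p ` (e \<inter> f)"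
  using assms unfolding is_drawing_def by simp_all

text \<open>A drawing restricts to the subgraph, and cycles of the subgraph are cycles of the
  graph.\<close>

lemma sparse_planar_induced:
  assumes "sparse_planar V E" "V' \<subseteq> V"
  shows "sparse_planar V' (induced_edges E V')"
proof -
  let ?E = "induced_edges E V'"
  have sg: "simple_graph V E" and pg: "planar_graph V E" using assms by (auto simp: sparse_planar_def)
  have "simple_graph V' ?E"
    using simple_graph_finite[OF sg] assms(2) by (auto simp: simple_graph_def induced_edges_def intro: finite_subset)
  moreover have "planar_graph V' ?E"
  proof -
    obtain p \<gamma> where dr: "is_drawing V E p \<gamma>" using pg planar_graph_iff_drawing by blast
    note g = is_drawingD[OF dr]
    have "path_image (\<gamma> e) \<inter> p ` V' = p ` e" if e: "e \<in> ?E" for e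
    proof -
      have "e \<in> E" "e \<subseteq> V'" using e by (auto simp: induced_edges_def)
      then have e': "p ` e \<subseteq> p ` V'" "path_image (\<gamma> e) \<inter> p ` V = p ` e" using g(4) by auto
      have "p ` V' \<subseteq> p ` V" using assms(2) by auto
      then have "path_image (\<gamma> e) \<inter> p ` V' = (path_image (\<gamma> e) \<inter> p ` V) \<inter> p ` V'"
        by (simp add: Int_assoc Int_absorb1)
      then show ?thesis using e' by (simp add: Int_absorb2)
    qed
    then have "is_drawing V' ?E p \<gamma>" unfolding is_drawing_def
      using g(2,3,5) inj_on_subset[OF g(1) assms(2)] induced_edges_subset[of E V'] by (simp add: subset_iff)
    then show ?thesis using planar_graph_iff_drawing by blast
  qed
  ultimately show ?thesis
    using assms(1) is_cycle_mono[OF _ induced_edges_subset] unfolding sparse_planar_def by blast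
qed

section \<open>Unavoidable and reducible configurations\<close>

lemma unavoidable_configurations:
  assumes "sparse_planar V E" "V \<noteq> {}"
  defines "d \<equiv> degree_in E"
  shows "(\<exists>v\<in>V. d v \<le> 1) \<or> (\<exists>v w. {v, w} \<in> E \<and> d v = 2 \<and> d w \<le> 6) \<or>
    (\<exists>v a b. {v, a} \<in> E \<and> {v, b} \<in> E \<and> a \<noteq> b \<and> d v = 3 \<and> d a \<le> 4 \<and> d b \<le> 6) \<or>
    (\<exists>v a b. {v, a} \<in> E \<and> {v, b} \<in> E \<and> {a, b} \<in> E \<and> d v = 3 \<and> d a \<le> 5 \<and> d b \<le> 7)"
proof (rule ccontr)
  assume no: "\<not> ?thesis"
  have sg: "simple_graph V E" and pg: "planar_graph V E" using assms by (auto simp: sparse_planar_def)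
  obtain p \<gamma> where dr: "is_drawing V E p \<gamma>" using pg planar_graph_iff_drawing by blast
  note g = is_drawingD(2,3,5)[OF dr]
  note fin = simple_graph_finite[OF sg]
  \<comment> \<open>Absence of the four configurations is the list of degree assumptions of the
    locale, which is contradictory.\<close>
  have "discharging p \<gamma> E V"
  proof
    show "2 \<le> degree_in E v" if "v \<in> V" for v using no that unfolding d_def by fastforce
    show "7 \<le> degree_in E w" if "{v, w} \<in> E" "degree_in E v = 2" for v w
    proof (rule ccontr)
      assume "\<not> 7 \<le> degree_in E w"
      then have "degree_in E w \<le> 6" by simp
      then show False using no that unfolding d_def by blast
    qed
    show "7 \<le> degree_in E b" if "{v, a} \<in> E" "{v, b} \<in> E" "a \<noteq> b" "degree_in E v = 3" "degree_in E a \<le> 4" for v a b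
    proof (rule ccontr)
      assume "\<not> 7 \<le> degree_in E b"
      then have "degree_in E b \<le> 6" by simp
      then show False using no that unfolding d_def by blast
    qed
    show "8 \<le> degree_in E b" if "{v, a} \<in> E" "{v, b} \<in> E" "{a, b} \<in> E" "degree_in E v = 3" "degree_in E a \<le> 5" for v a b
    proof (rule ccontr)
      assume "\<not> 8 \<le> degree_in E b"
      then have "degree_in E b \<le> 7" by simp
      then show False using no that unfolding d_def by blast
    qed
    show "independent_cycles C D" if "is_cycle E C" "is_cycle E D" "C \<noteq> D" "card C \<le> 4" "card D \<le> 4" for C D
      using assms(1) that unfolding sparse_planar_def by blast
  qed (use fin g assms(2) in simp_all)
  then show False by (rule discharging.contradiction)
qed

text \<open>Each configuration contains a vertex of degree at most 3. It is sought in the subgraph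
  on \<open>V - S\<close>, whose degrees count the neighbours outside \<open>S\<close>.\<close>

lemma three_degenerate:
  assumes "sparse_planar V E" "V - S \<noteq> {}"
  obtains v where "v \<in> V - S" "card (nbrs E v - S) \<le> 3"
proof -
  let ?E = "induced_edges E (V - S)"
  have sp: "sparse_planar (V - S) ?E" using sparse_planar_induced[OF assms(1)] by auto
  then have sg: "simple_graph (V - S) ?E" by (simp add: sparse_planar_def)
  have sgE: "simple_graph V E" using assms(1) by (simp add: sparse_planar_def)
  from unavoidable_configurations[OF sp assms(2)] consider
    v where "v \<in> V - S" "degree_in ?E v \<le> 1" | v w where "{v, w} \<in> ?E" "degree_in ?E v = 2"
    | v w where "{v, w} \<in> ?E" "degree_in ?E v = 3"
    by blast
  then have "\<exists>v. v \<in> V - S \<and> degree_in ?E v \<le> 3"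
  proof cases
    case (1 v)
    then show ?thesis by (intro exI[of _ v]) simp
  next
    case (2 v w)
    then show ?thesis using simple_graph_edge(1)[OF sg 2(1)] by (intro exI[of _ v]) simp
  next
    case (3 v w)
    then show ?thesis using simple_graph_edge(1)[OF sg 3(1)] by (intro exI[of _ v]) simp
  qed
  then obtain v where v: "v \<in> V - S" "degree_in ?E v \<le> 3" by blast
  have "nbrs ?E v = nbrs E v - S" using nbrs_induced[OF v(1)] nbrs_subset[OF sgE] by blast
  then show ?thesis using that v degree_in_eq_card_nbrs[OF sg] by metis
qed

text \<open>A vertex of degree at most 1 serves as \<open>x\<close>; a 2-vertex and its neighbour of
  degree at most 6 serve as \<open>x\<close> and \<open>z\<close>. The other two configurations are
  triples themselves, and neighbours inside are subtracted, such as \<open>7 - 2 = 5\<close> in the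
  triangle. Open places are filled by \<open>three_degenerate\<close>, as 3 is within the bounds for
  \<open>y\<close> and \<open>z\<close>.\<close>

lemma reducible_triple:
  assumes sp: "sparse_planar V E" and "3 \<le> card V"
  obtains x y z where "x \<in> V" "y \<in> V" "z \<in> V" "distinct [x, y, z]"
    "card (nbrs E x - {x, y, z}) \<le> 1" "card (nbrs E y - {x, y, z}) \<le> 3" "card (nbrs E z - {x, y, z}) \<le> 5"
proof -
  have sg: "simple_graph V E" using sp by (simp add: sparse_planar_def)
  have finV: "finite V" using simple_graph_finite[OF sg] by blast
  have rest: "V - {a, b} \<noteq> {}" for a b
  proof
    assume "V - {a, b} = {}"
    then have "card V \<le> card {a, b}" by (intro card_mono) auto
    then show False using assms(2) card_insert_le_m1[of 2 "{b}" a] by simp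
  qed
  note fn = finite_nbrs[OF sg]
  have mono: "card (nbrs E v - T) \<le> card (nbrs E v - S)" if "S \<subseteq> T" for v S T
    using that fn by (intro card_mono) auto
  have drop: "card (nbrs E v - T) \<le> card (nbrs E v) - card S" if "S \<subseteq> T" "S \<subseteq> nbrs E v" for v S T
  proof -
    have "card (nbrs E v - T) \<le> card (nbrs E v - S)" using mono that by blast
    also have "\<dots> = card (nbrs E v) - card S" using that fn by (intro card_Diff_subset) (auto intro: finite_subset)
    finally show ?thesis .
  qed
  note deg = degree_in_eq_card_nbrs[OF sg]
  have "V \<noteq> {}" using assms(2) by auto
  from unavoidable_configurations[OF sp this] consider
    (1) v where "v \<in> V" "degree_in E v \<le> 1"
    | (2) v w where "{v, w} \<in> E" "degree_in E v = 2" "degree_in E w \<le> 6"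
    | (3) v a b where "{v, a} \<in> E" "{v, b} \<in> E" "a \<noteq> b" "degree_in E v = 3" "degree_in E a \<le> 4" "degree_in E b \<le> 6"
    | (4) v a b where "{v, a} \<in> E" "{v, b} \<in> E" "{a, b} \<in> E" "degree_in E v = 3" "degree_in E a \<le> 5" "degree_in E b \<le> 7"
    by blast
  then show ?thesis
  proof cases
    case (1 x)
    obtain y where y: "y \<in> V - {x}" "card (nbrs E y - {x}) \<le> 3"
      using three_degenerate[OF sp rest[of x x]] by auto
    obtain z where z: "z \<in> V - {x, y}" "card (nbrs E z - {x, y}) \<le> 3"
      using three_degenerate[OF sp rest[of x y]] by blast
    have "card (nbrs E x - {x, y, z}) \<le> 1" using drop[of "{}" "{x, y, z}" x] 1 deg by simp
    moreover have "card (nbrs E y - {x, y, z}) \<le> 3" using mono[of "{x}" "{x, y, z}" y] y by simp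
    moreover have "card (nbrs E z - {x, y, z}) \<le> 5" using mono[of "{x, y}" "{x, y, z}" z] z by simp
    ultimately show ?thesis using that[of x y z] 1 y z by auto
  next
    case (2 x z)
    note e = simple_graph_edge[OF sg 2(1)]
    obtain y where y: "y \<in> V - {x, z}" "card (nbrs E y - {x, z}) \<le> 3"
      using three_degenerate[OF sp rest[of x z]] by blast
    have "z \<in> nbrs E x" using 2 by (auto simp: nbrs_def)
    then have "card (nbrs E x - {x, y, z}) \<le> 1" using drop[of "{z}" "{x, y, z}" x] 2 deg by simp
    moreover have "card (nbrs E y - {x, y, z}) \<le> 3" using mono[of "{x, z}" "{x, y, z}" y] y by simp
    moreover have "x \<in> nbrs E z" using 2 by (auto simp: nbrs_def insert_commute)
    then have "card (nbrs E z - {x, y, z}) \<le> 5" using drop[of "{x}" "{x, y, z}" z] 2 deg[of z] by simp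
    ultimately show ?thesis using that[of x y z] e y by auto
  next
    case (3 x y z)
    note e = simple_graph_edge[OF sg 3(1)] simple_graph_edge[OF sg 3(2)]
    have n: "y \<in> nbrs E x" "z \<in> nbrs E x" "x \<in> nbrs E y" "x \<in> nbrs E z"
      using 3 by (auto simp: nbrs_def insert_commute)
    have "card (nbrs E x - {x, y, z}) \<le> 1" using drop[of "{y, z}" "{x, y, z}" x] n 3 deg[of x] by simp
    moreover have "card (nbrs E y - {x, y, z}) \<le> 3" using drop[of "{x}" "{x, y, z}" y] n 3 deg[of y] by simp
    moreover have "card (nbrs E z - {x, y, z}) \<le> 5" using drop[of "{x}" "{x, y, z}" z] n 3 deg[of z] by simp
    ultimately show ?thesis using that[of x y z] e 3 by auto
  next
    case (4 x y z)
    note e = simple_graph_edge[OF sg 4(1)] simple_graph_edge[OF sg 4(2)] simple_graph_edge[OF sg 4(3)]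
    have n: "y \<in> nbrs E x" "z \<in> nbrs E x" "x \<in> nbrs E y" "x \<in> nbrs E z" "z \<in> nbrs E y" "y \<in> nbrs E z"
      using 4 by (auto simp: nbrs_def insert_commute)
    have "card (nbrs E x - {x, y, z}) \<le> 1" using drop[of "{y, z}" "{x, y, z}" x] n 4 e deg[of x] by simp
    moreover have "card (nbrs E y - {x, y, z}) \<le> 3" using drop[of "{x, z}" "{x, y, z}" y] n 4 e deg[of y] by simp
    moreover have "card (nbrs E z - {x, y, z}) \<le> 5" using drop[of "{x, y}" "{x, y, z}" z] n 4 e deg[of z] by simp
    ultimately show ?thesis using that[of x y z] e by auto
  qed
qed

text \<open>Positions count from 0, so the bound \<open>2 * i - 1\<close> for the
  \<open>i\<close>-th vertex becomes \<open>2 * i + 1\<close>. After the initial triple the bound is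
  at least 7, so a vertex with at most 3 outside neighbours can be appended; appending never raises
  the earlier counts.\<close>

lemma reducible_list:
  assumes sp: "sparse_planar V E" and "3 \<le> t" "t \<le> card V"
  shows "\<exists>xs. length xs = t \<and> distinct xs \<and> set xs \<subseteq> V \<and>
    (\<forall>i<t. card (nbrs E (xs ! i) - set xs) \<le> 2 * i + 1)"
  using assms(2,3)
proof (induction t rule: dec_induct)
  case base
  obtain x y z where "x \<in> V" "y \<in> V" "z \<in> V" "distinct [x, y, z]"
    "card (nbrs E x - {x, y, z}) \<le> 1" "card (nbrs E y - {x, y, z}) \<le> 3" "card (nbrs E z - {x, y, z}) \<le> 5"
    using reducible_triple[OF sp] base by blast
  then show ?case
    by (intro exI[of _ "[x, y, z]"]) (auto simp: less_Suc_eq numeral_3_eq_3)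
next
  case (step n)
  then obtain xs where xs: "length xs = n" "distinct xs" "set xs \<subseteq> V"
    "\<forall>i<n. card (nbrs E (xs ! i) - set xs) \<le> 2 * i + 1" by auto
  have sg: "simple_graph V E" using sp by (simp add: sparse_planar_def)
  have "card (set xs) < card V" using xs step by (simp add: distinct_card)
  then have "V - set xs \<noteq> {}" by (metis Diff_eq_empty_iff card_mono finite_set not_less)
  then obtain x where x: "x \<in> V - set xs" "card (nbrs E x - set xs) \<le> 3"
    using three_degenerate[OF sp] by blast
  have mono: "card (nbrs E v - set (xs @ [x])) \<le> card (nbrs E v - set xs)" for v
    using finite_nbrs[OF sg] by (intro card_mono) auto
  have "card (nbrs E ((xs @ [x]) ! i) - set (xs @ [x])) \<le> 2 * i + 1" if "i < Suc n" for i
  proof (cases "i < n")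
    case True
    then show ?thesis using xs mono[of "xs ! i"] by (simp add: nth_append) (meson order_trans)
  next
    case False
    then have "i = n" using that by simp
    then show ?thesis using xs x mono[of x] step by (simp add: nth_append)
  qed
  then show ?case using xs x by (intro exI[of _ "xs @ [x]"]) auto
qed

text \<open>The last vertex chooses first, while all colours are available; each choice removes one
  colour and lowers the bound for the next vertex by 2. Hence the induction from the end of the
  list.\<close>

lemma greedy_color_assignment:
  fixes N :: "'a \<Rightarrow> 'a set" and P :: "'c \<Rightarrow> 'a set"
  assumes "finite A" "card A = length xs" "distinct xs" "disjoint_family_on P A" "finite U"
    and "\<And>c. c \<in> A \<Longrightarrow> P c \<subseteq> U" "\<And>i. i < length xs \<Longrightarrow> card (N (xs ! i) \<inter> U) \<le> 2 * i + 1"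
  shows "\<exists>f. bij_betw f A (set xs) \<and> (\<forall>c\<in>A. card (N (f c) \<inter> P c) \<le> 1)"
  using assms
proof (induction xs arbitrary: A rule: rev_induct)
  case Nil
  then show ?case by (auto simp: bij_betw_def)
next
  case (snoc x xs)
  have Nx: "card (N x \<inter> U) \<le> 2 * length xs + 1" using snoc.prems(7)[of "length xs"] by simp
  have "\<exists>c\<in>A. card (N x \<inter> P c) \<le> 1"
  proof (rule ccontr)
    assume "\<not> ?thesis"
    \<comment> \<open>With \<open>length xs + 1\<close> disjoint classes, two neighbours in each
      would give \<open>2 * length xs + 2\<close>, one more than allowed.\<close>
    then have "(\<Sum>c\<in>A. 2) \<le> (\<Sum>c\<in>A. card (N x \<inter> P c))" by (intro sum_mono) auto
    also have "\<dots> = card (\<Union>c\<in>A. N x \<inter> P c)"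
    proof (rule card_UN_disjoint[symmetric])
      show "\<forall>c\<in>A. finite (N x \<inter> P c)" using snoc.prems by (meson finite_Int finite_subset)
      show "\<forall>c\<in>A. \<forall>c'\<in>A. c \<noteq> c' \<longrightarrow> N x \<inter> P c \<inter> (N x \<inter> P c') = {}"
        using snoc.prems(4) by (auto simp: disjoint_family_on_def)
    qed (use snoc.prems in auto)
    also have "\<dots> \<le> card (N x \<inter> U)" using snoc.prems(5,6) by (intro card_mono) auto
    finally show False using Nx snoc.prems(2) by simp
  qed
  then obtain c where c: "c \<in> A" "card (N x \<inter> P c) \<le> 1" by blast
  have "\<exists>f. bij_betw f (A - {c}) (set xs) \<and> (\<forall>c\<in>A - {c}. card (N (f c) \<inter> P c) \<le> 1)"
  proof (rule snoc.IH)
    show "disjoint_family_on P (A - {c})" using snoc.prems(4) by (auto simp: disjoint_family_on_def)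
    show "card (N (xs ! i) \<inter> U) \<le> 2 * i + 1" if "i < length xs" for i
      using snoc.prems(7)[of i] that by (simp add: nth_append)
  qed (use snoc.prems c in auto)
  then obtain f where f: "bij_betw f (A - {c}) (set xs)" "\<forall>c\<in>A - {c}. card (N (f c) \<inter> P c) \<le> 1" by blast
  let ?f = "f(c := x)"
  have "?f ` A = insert x (f ` (A - {c}))" using c(1) by auto
  moreover have "inj_on ?f A"
    using f(1) snoc.prems(3) by (auto simp: bij_betw_def inj_on_def)
  ultimately have "bij_betw ?f A (set (xs @ [x]))" using f(1) by (auto simp: bij_betw_def)
  moreover have "\<forall>c'\<in>A. card (N (?f c') \<inter> P c') \<le> 1" using f(2) c by simp
  ultimately show ?case by blast
qed

text \<open>A cycle through \<open>x\<close> would use two distinct neighbours of \<open>x\<close>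
  in \<open>S\<close>.\<close>

lemma is_forest_insert_vertex:
  assumes forest: "is_forest (induced_edges E S)" and one: "card (nbrs E x \<inter> S) \<le> 1" and fin: "finite S"
  shows "is_forest (induced_edges E (insert x S))"
  unfolding is_forest_def
proof
  assume "\<exists>C. is_cycle (induced_edges E (insert x S)) C"
  then obtain C where C: "is_cycle (induced_edges E (insert x S)) C" by blast
  have sub: "C \<subseteq> E" "\<And>e. e \<in> C \<Longrightarrow> e \<subseteq> insert x S"
    using is_cycle_subset[OF C] by (auto simp: induced_edges_def)
  show False
  proof (cases "x \<in> \<Union>C")
    case True
    then obtain u w where uw: "u \<noteq> w" "u \<noteq> x" "w \<noteq> x" "{x, u} \<in> C" "{x, w} \<in> C"
      using cycle_two_neighbours[OF C] by metis
    then have "{u, w} \<subseteq> nbrs E x \<inter> S" using sub by (auto simp: nbrs_def)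
    then have "card {u, w} \<le> card (nbrs E x \<inter> S)" using fin by (intro card_mono) auto
    then show False using one uw by simp
  next
    case False
    then have "C \<subseteq> induced_edges E S" using sub by (auto simp: induced_edges_def)
    then show False using forest is_cycle_restrict[OF C] unfolding is_forest_def by blast
  qed
qed

section \<open>Equitable colourings: the small case and the extension\<close>

lemma equitable_tree_coloring_few_vertices:
  assumes sg: "simple_graph V E" and "card V < t"
  shows "has_equitable_tree_coloring V E t"
proof -
  have finV: "finite V" using simple_graph_finite[OF sg] by blast
  obtain f where f: "bij_betw f {..<card V} V" using ex_bij_betw_nat_finite[OF finV] by (auto simp: lessThan_atLeast0)
  \<comment> \<open>With fewer vertices than colours the classes are singletons and empty sets,
    whose sizes 1 and 0 are the ceiling and the floor of the quotient.\<close>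
  define P where "P i = (if i < card V then {f i} else {})" for i
  have forest: "is_forest (induced_edges E (P i))" for i
  proof -
    have "induced_edges E (P i) = {}"
    proof (rule ccontr)
      assume "induced_edges E (P i) \<noteq> {}"
      then obtain e where e: "e \<in> E" "e \<subseteq> P i" by (auto simp: induced_edges_def)
      have "card e \<le> card (P i)" using e by (intro card_mono) (auto simp: P_def)
      also have "\<dots> \<le> 1" by (simp add: P_def)
      finally show False using simple_graph_finite(4)[OF sg e(1)] by simp
    qed
    then show ?thesis unfolding is_forest_def using is_cycle_subset cycle_finite by (metis subset_empty)
  qed
  have "disjoint_family_on P {..<t}"
    using f by (auto simp: disjoint_family_on_def P_def bij_betw_def inj_on_def)
  moreover have "(\<Union>i<t. P i) = V"
  proof -
    have "(\<Union>i<t. P i) = f ` {..<card V}" using assms(2) by (force simp: P_def split: if_splits)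
    then show ?thesis using f by (simp add: bij_betw_def)
  qed
  moreover have "int (card (P i)) = \<lceil>real (card V) / real t\<rceil> \<or> int (card (P i)) = \<lfloor>real (card V) / real t\<rfloor>" for i
  proof -
    have "\<lfloor>real (card V) / real t\<rfloor> = 0" using assms(2) by (simp add: floor_eq_iff)
    moreover have "\<lceil>real (card V) / real t\<rceil> = 1" if "i < card V"
      using assms(2) that by (simp add: ceiling_eq_iff)
    ultimately show ?thesis by (auto simp: P_def)
  qed
  ultimately show ?thesis unfolding has_equitable_tree_coloring_def equitable_tree_coloring_def
    using forest by blast
qed

text \<open>Induction in steps of \<open>t\<close> vertices: a colouring of the graph without a
  reducible list extends by giving the listed vertices pairwise distinct colours.\<close>

lemma sparse_planar_equitable_tree_coloring:
  assumes "sparse_planar V E" "3 \<le> t"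
  shows "has_equitable_tree_coloring V E t"
  using assms(1)
proof (induction "card V" arbitrary: V E rule: less_induct)
  case less
  have sg: "simple_graph V E" using less.prems by (simp add: sparse_planar_def)
  have finV: "finite V" using simple_graph_finite[OF sg] by blast
  show ?case
  proof (cases "card V < t")
    case True
    then show ?thesis using equitable_tree_coloring_few_vertices[OF sg] by blast
  next
    case False
    then obtain xs where xs: "length xs = t" "distinct xs" "set xs \<subseteq> V"
      "\<forall>i<t. card (nbrs E (xs ! i) - set xs) \<le> 2 * i + 1"
      using reducible_list[OF less.prems assms(2)] by auto
    define V' where "V' = V - set xs"
    have cV: "card V = card V' + t"
      using xs finV card_Diff_subset[of "set xs" V] card_mono[of V "set xs"] False
      by (simp add: V'_def distinct_card)
    have "has_equitable_tree_coloring V' (induced_edges E V') t"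
      using less cV assms(2) by (intro less.hyps sparse_planar_induced[of V]) (auto simp: V'_def)
    then obtain P where P: "disjoint_family_on P {..<t}" "(\<Union>i<t. P i) = V'"
      "\<And>i. i < t \<Longrightarrow> int (card (P i)) = \<lceil>real (card V') / real t\<rceil> \<or> int (card (P i)) = \<lfloor>real (card V') / real t\<rfloor>"
      "\<And>i. i < t \<Longrightarrow> is_forest (induced_edges (induced_edges E V') (P i))"
      unfolding has_equitable_tree_coloring_def equitable_tree_coloring_def by blast
    have PV: "P i \<subseteq> V'" if "i < t" for i using P(2) that by blast
    have nb: "nbrs E v \<inter> V' = nbrs E v - set xs" for v using nbrs_subset[OF sg] unfolding V'_def by blast
    have "\<exists>f. bij_betw f {..<t} (set xs) \<and> (\<forall>c\<in>{..<t}. card (nbrs E (f c) \<inter> P c) \<le> 1)"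
    proof (rule greedy_color_assignment[where U = V'])
      show "card (nbrs E (xs ! i) \<inter> V') \<le> 2 * i + 1" if "i < length xs" for i
        using xs(1,4) that unfolding nb by simp
      show "finite V'" using finV by (simp add: V'_def)
    qed (use xs P(1) PV in auto)
    then obtain f where f: "bij_betw f {..<t} (set xs)" "\<And>i. i < t \<Longrightarrow> card (nbrs E (f i) \<inter> P i) \<le> 1" by blast
    have fx: "f i \<in> set xs" if "i < t" for i using f(1) that by (auto simp: bij_betw_def)
    define Q where "Q i = insert (f i) (P i)" for i
    have fP: "f i \<notin> P j" if "i < t" "j < t" for i j using PV[OF that(2)] fx[OF that(1)] by (auto simp: V'_def)
    have finP: "finite (P i)" if "i < t" for i using PV[OF that] finV by (auto simp: V'_def intro: finite_subset)
    have "disjoint_family_on Q {..<t}"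
      unfolding disjoint_family_on_def
    proof (intro ballI impI)
      fix i j assume ij: "i \<in> {..<t}" "j \<in> {..<t}" "i \<noteq> j"
      then have "f i \<noteq> f j" using f(1) by (auto simp: bij_betw_def inj_on_def)
      moreover have "P i \<inter> P j = {}" using P(1) ij by (auto simp: disjoint_family_on_def)
      ultimately show "Q i \<inter> Q j = {}" using fP[of i j] fP[of j i] ij by (auto simp: Q_def)
    qed
    moreover have "(\<Union>i<t. Q i) = V"
    proof -
      have "(\<Union>i<t. Q i) = f ` {..<t} \<union> (\<Union>i<t. P i)" by (auto simp: Q_def)
      then show ?thesis using f(1) P(2) xs(3) by (auto simp: bij_betw_def V'_def)
    qed
    moreover have "int (card (Q i)) = \<lceil>real (card V) / real t\<rceil> \<or> int (card (Q i)) = \<lfloor>real (card V) / real t\<rfloor>"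
      if "i < t" for i
    proof -
      \<comment> \<open>Restoring exactly \<open>t\<close> vertices raises the quotient by 1, so
        floor and ceiling shift together with the class sizes.\<close>
      have "real (card V) / real t = real (card V') / real t + 1" using cV assms(2) by (simp add: add_divide_distrib)
      moreover have "card (Q i) = Suc (card (P i))" using finP fP that by (simp add: Q_def)
      ultimately show ?thesis using P(3)[OF that] by auto
    qed
    moreover have "is_forest (induced_edges E (Q i))" if "i < t" for i
    proof -
      have "induced_edges (induced_edges E V') (P i) = induced_edges E (P i)"
        using PV[OF that] by (auto simp: induced_edges_def)
      then show ?thesis unfolding Q_def
        using is_forest_insert_vertex[OF _ f(2)[OF that] finP[OF that]] P(4)[OF that] by simp
    qed
    ultimately show ?thesis unfolding has_equitable_tree_coloring_def equitable_tree_coloring_def by blast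
  qed
qed

theorem theorem1:
  fixes V :: "'a set" and E :: "'a set set"
  assumes "simple_graph V E"
    and "planar_graph V E"
    and "\<And>C D. is_cycle E C \<Longrightarrow> is_cycle E D \<Longrightarrow> C \<noteq> D \<Longrightarrow>
           card C \<le> 4 \<Longrightarrow> card D \<le> 4 \<Longrightarrow> independent_cycles C D"
  shows "strong_equitable_vertex_arboricity V E \<le> 3 \<and>
         (\<forall>t\<ge>3. has_equitable_tree_coloring V E t)"
proof -
  have "sparse_planar V E" using assms unfolding sparse_planar_def by blast
  then have col: "\<forall>t\<ge>3. has_equitable_tree_coloring V E t"
    using sparse_planar_equitable_tree_coloring by blast
  then have "strong_equitable_vertex_arboricity V E \<le> 3"
    unfolding strong_equitable_vertex_arboricity_def by (intro Least_le) auto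
  then show ?thesis using col by blast
qed

end
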